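(* Every signed graph $G$ with maximum average degree $\mathrm{mad}(G) < \frac{20}{7}$ admits a homomorphism to the signed Paley graph $SP_5$. That is, $\chi_s(\mathcal{M}_{\frac{20}{7}}) \le 5$.
   Context: A signed graph $G=(V,E,s)$ is a finite simple graph $(V,E)$ (no loops, no parallel edges) together with a signature $s:E\to\{-1,+1\}$; edges with sign $+1$ are positive, with sign $-1$ negative. Switching a vertex $v$ reverses the sign of every edge incident to $v$; two signed graphs are switching equivalent if one can be obtained from the other by a sequence of switches. For signed graphs $G$ and $H$, a map $\varphi:V(G)\to V(H)$ is a homomorphism if there is a signed graph $G'$ switching equivalent to $G$ such that for every edge $uv$ of $G'$, $\varphi(u)\varphi(v)$ is an edge of $H$ with the same sign as $uv$ in $G'$. The chromatic number $\chi_s(G)$ is the minimum order of a signed graph $H$ such that $G$ admits a homomorphism to $H$; for a class $\mathcal{C}$ of signed graphs, $\chi_s(\mathcal{C})$ is the maximum of $\chi_s(G)$ over $G\in\mathcal{C}$. The maximum average degree $\mathrm{mad}(G)$ is the maximum of $2|E(H)|/|V(H)|$ over all (nonempty) subgraphs $H$ of the underlying graph; $\mathcal{M}_k$ denotes the class of signed graphs with $\mathrm{mad} < k$. For a prime power $q\equiv 1 \pmod 4$, the signed Paley graph $SP_q$ has vertex set the finite field $\mathbb{F}_q$, and any two distinct vertices $u,v$ are joined by a positive edge if $u-v$ is a square in $\mathbb{F}_q$ and by a negative edge otherwise (so $SP_q$ is a complete signed graph on $q$ vertices). *)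

theory Defs
  imports Complex_Main "HOL-Number_Theory.Cong"
begin

definition signed_graph :: "'a set \<Rightarrow> 'a set set \<Rightarrow> ('a set \<Rightarrow> int) \<Rightarrow> bool" where
  "signed_graph V E s \<longleftrightarrow> finite V \<and>
     (\<forall>e\<in>E. \<exists>u v. u \<in> V \<and> v \<in> V \<and> u \<noteq> v \<and> e = {u, v}) \<and>
     (\<forall>e\<in>E. s e = 1 \<or> s e = -1)"

definition switch_vertex :: "'a \<Rightarrow> ('a set \<Rightarrow> int) \<Rightarrow> ('a set \<Rightarrow> int)" where
  "switch_vertex v s = (\<lambda>e. if v \<in> e then - s e else s e)"

inductive switch_equiv :: "'a set \<Rightarrow> 'a set set \<Rightarrow> ('a set \<Rightarrow> int) \<Rightarrow> ('a set \<Rightarrow> int) \<Rightarrow> bool"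
  for V :: "'a set" and E :: "'a set set" where
  refl: "switch_equiv V E s s"
| step: "switch_equiv V E s t \<Longrightarrow> v \<in> V \<Longrightarrow> switch_equiv V E s (switch_vertex v t)"

definition signed_hom ::
  "'a set \<Rightarrow> 'a set set \<Rightarrow> ('a set \<Rightarrow> int) \<Rightarrow>
   'b set \<Rightarrow> 'b set set \<Rightarrow> ('b set \<Rightarrow> int) \<Rightarrow> ('a \<Rightarrow> 'b) \<Rightarrow> bool" where
  "signed_hom V E s VH EH sH \<phi> \<longleftrightarrow>
     (\<forall>v\<in>V. \<phi> v \<in> VH) \<and>
     (\<exists>s'. switch_equiv V E s s' \<and>
        (\<forall>u v. {u, v} \<in> E \<longrightarrow> {\<phi> u, \<phi> v} \<in> EH \<and> sH {\<phi> u, \<phi> v} = s' {u, v}))"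

definition mad :: "'a set \<Rightarrow> 'a set set \<Rightarrow> real" where
  "mad V E = Max {2 * real (card F) / real (card W) | W F.
                   W \<subseteq> V \<and> W \<noteq> {} \<and> F \<subseteq> E \<and> (\<forall>e\<in>F. e \<subseteq> W)}"

definition SP5_V :: "int set" where
  "SP5_V = {0..4}"

definition SP5_E :: "int set set" where
  "SP5_E = {{u, v} | u v. u \<in> SP5_V \<and> v \<in> SP5_V \<and> u \<noteq> v}"

definition SP5_s :: "int set \<Rightarrow> int" where
  "SP5_s e = (if \<exists>u v x. e = {u, v} \<and> [x ^ 2 = u - v] (mod 5) then 1 else -1)"

end

(* A homomorphism to SP_5 up to switching is a sign-preserving colouring by the ten vertices of the
   switching double cover of SP_5, a circulant graph on Z/10. A vertex of degree 2 ("light")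
   excludes a single colour at one neighbour once the other one is coloured, and a 3-vertex with one
   light neighbour (a "semi" vertex) excludes at most two, one of each parity, at its remaining neighbour.
   Call a 3-vertex without 2-neighbours "plain", and "bad" if it has two semi neighbours; it excludes
   at most one colour at its third neighbour. Counting excluded colours, a minimal counterexample has
   no vertex of degree at most 1, no adjacent 2-vertices, no 3-vertex with two and no 4-vertex with
   three 2-neighbours, no adjacent semi vertices, no plain vertex with three semi neighbours, with a
   semi and a bad neighbour, or with two bad neighbours. Give v the charge 7 deg(v) - 20, of negative
   total as mad < 20/7, and let every vertex send 3 to each 2-neighbour, 1 to each semi neighbour
   (unless the sender has degree 2) and 1 to each bad neighbour (unless the sender is semi). Then no
   charge is negative. *)
theory Submission
  imports Defs "HOL-Library.Numeral_Type"
begin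

section \<open>Colours\<close>

text \<open>The colour \<open>c\<close> in \<open>\<int>/10\<close> stands for the vertex \<open>c mod 5\<close> of \<open>SP\<^sub>5\<close>, used without a switch if \<open>c\<close>
  is even and with a switch if \<open>c\<close> is odd; hence \<open>c + 5\<close> is the switched copy of \<open>c\<close>.\<close>

definition pos_adj :: "10 \<Rightarrow> 10 \<Rightarrow> bool" where
  "pos_adj c d \<longleftrightarrow> c - d \<in> {3, 4, 6, 7}"

definition flip :: "bool \<Rightarrow> 10 \<Rightarrow> 10" where
  "flip b c = (if b then c else c + 5)"

definition adj :: "bool \<Rightarrow> 10 \<Rightarrow> 10 \<Rightarrow> bool" where
  "adj b c d \<longleftrightarrow> pos_adj c (flip b d)"

definition even_col :: "10 \<Rightarrow> bool" where
  "even_col c \<longleftrightarrow> c \<in> {0, 2, 4, 6, 8}"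

lemma UNIV_10: "(UNIV :: 10 set) = {0, 1, 2, 3, 4, 5, 6, 7, 8, 9}"
proof -
  have "card {0, 1, 2, 3, 4, 5, 6, 7, 8, 9 :: 10} = CARD(10)" by simp
  then show ?thesis by (metis card_subset_eq finite subset_UNIV)
qed

text \<open>Turns a statement on all colours into ten ground instances for \<open>simp\<close>;
  translation invariance (\<open>pos_adj_shift\<close>) often allows one colour to be fixed at
  0.\<close>

lemma all_10: "(\<forall>x::10. P x) \<longleftrightarrow>
    P 0 \<and> P 1 \<and> P 2 \<and> P 3 \<and> P 4 \<and> P 5 \<and> P 6 \<and> P 7 \<and> P 8 \<and> P 9"
  using UNIV_10 by (metis (no_types, lifting) UNIV_I insert_iff empty_iff)

lemma ex_10: "(\<exists>x::10. P x) \<longleftrightarrow>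
    P 0 \<or> P 1 \<or> P 2 \<or> P 3 \<or> P 4 \<or> P 5 \<or> P 6 \<or> P 7 \<or> P 8 \<or> P 9"
  using all_10[of "\<lambda>x. \<not> P x"] by blast

lemma five_five: "(5::10) + 5 = 0" "x + 5 + 5 = (x::10)"
  by (simp_all add: add.assoc)

lemma flip_flip [simp]: "flip b (flip b c) = c"
  by (simp add: flip_def five_five)

lemma flip_eq_iff [simp]: "flip b c = flip b d \<longleftrightarrow> c = d"
  by (metis flip_flip)

lemma pos_adj_shift: "pos_adj (c + a) (d + a) \<longleftrightarrow> pos_adj c d"
  by (simp add: pos_adj_def)

lemma pos_adj_sym: "pos_adj c d \<longleftrightarrow> pos_adj d c"
proof -
  have "\<forall>x::10. x \<in> {3, 4, 6, 7} \<longleftrightarrow> - x \<in> {3, 4, 6, 7}"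
    unfolding all_10 by simp
  from this[rule_format, of "c - d"] show ?thesis by (simp add: pos_adj_def)
qed

lemma pos_adj_flip: "pos_adj (flip b c) d \<longleftrightarrow> pos_adj c (flip b d)"
proof (cases b)
  case False
  then show ?thesis using pos_adj_shift[of c 5 "d + 5"] unfolding flip_def five_five by simp
qed (simp add: flip_def)

lemma adj_sym: "adj b c d \<longleftrightarrow> adj b d c"
  unfolding adj_def by (metis pos_adj_flip pos_adj_sym)

lemma even_col_shift: "even_col (c + 5) \<longleftrightarrow> \<not> even_col c"
proof -
  have "\<forall>c. even_col (c + 5) \<longleftrightarrow> \<not> even_col c" unfolding all_10 even_col_def by simp
  then show ?thesis by blast
qed

lemma even_col_flip: "even_col (flip b c) \<longleftrightarrow> (b \<longleftrightarrow> even_col c)"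
  by (simp add: flip_def even_col_shift)

lemma adj_shift: "adj b (c + 5) (d + 5) \<longleftrightarrow> adj b c d"
  using pos_adj_shift[of c 5 d] pos_adj_shift[of c 5 "d + 5"] unfolding adj_def flip_def by presburger

text \<open>Neither 0 nor 5 is among 3, 4, 6, 7: adjacent colours stand for different vertices of
  SP_5.\<close>

lemma adj_ne_flip: assumes "adj b c d" shows "c \<noteq> flip b' d"
proof -
  have "\<forall>x::10. x \<in> {3, 4, 6, 7} \<longrightarrow> x \<noteq> 0 \<and> x \<noteq> 5 \<and> x \<noteq> - 5"
    unfolding all_10 by simp
  from this[rule_format, of "c - flip b d"] assms show ?thesis
    by (auto simp: adj_def pos_adj_def flip_def algebra_simps five_five split: if_splits)
qed

section \<open>Signed paths and common neighbours of colours\<close>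

lemma two_path_pos: "(\<exists>m. pos_adj m c \<and> pos_adj m d) \<longleftrightarrow> d \<noteq> c + 5"
proof -
  \<comment> \<open>The set {3, 4, 6, 7} is closed under negation, and the sums of two of its
    elements are all residues except 5.\<close>
  have *: "\<forall>d::10. (\<exists>m. pos_adj m 0 \<and> pos_adj m d) \<longleftrightarrow> d \<noteq> 5"
    unfolding all_10 ex_10 pos_adj_def by simp
  have "(\<exists>m. pos_adj m c \<and> pos_adj m d) \<longleftrightarrow> (\<exists>m. pos_adj m 0 \<and> pos_adj m (d - c))"
    by (metis add.commute add_0 diff_add_cancel pos_adj_shift)
  then show ?thesis using *[rule_format, of "d - c"] by (metis add.commute diff_eq_eq)
qed

text \<open>The constraint of a 2-vertex coloured \<open>m\<close>: given \<open>c\<close>, its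
  other neighbour loses one colour, \<open>c + 5\<close> for equal signs and \<open>c\<close> for
  different ones.\<close>

lemma two_path: "(\<exists>m. adj b1 m c \<and> adj b2 m d) \<longleftrightarrow> d \<noteq> flip (b1 \<noteq> b2) c"
  unfolding adj_def two_path_pos
  by (cases b1; cases b2) (auto simp: flip_def five_five)

text \<open>At least two colours \<open>n\<close> are adjacent to \<open>d\<close> and
  \<open>two_path\<close> rules out only one, so two adjacent 2-vertices put no constraint on the
  ends of their path.\<close>

lemma three_path: "\<exists>m n. adj b1 m c \<and> adj b2 m n \<and> adj b3 n d"
proof -
  have "\<exists>n. adj b3 n d \<and> n \<noteq> flip (b1 \<noteq> b2) c"
  proof -
    have "\<exists>n1 n2. n1 \<noteq> n2 \<and> pos_adj n1 (flip b3 d) \<and> pos_adj n2 (flip b3 d)"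
      by (rule exI[of _ "flip b3 d + 3"], rule exI[of _ "flip b3 d + 4"]) (simp add: pos_adj_def)
    then show ?thesis unfolding adj_def by metis
  qed
  then show ?thesis by (metis two_path)
qed

text \<open>The colours \<open>t\<close> for which no \<open>u\<close> exists are \<open>x + 5\<close> and \<open>2 f - x\<close>, and these have different
  parities: among the colours of one parity at most one is lost.\<close>

lemma ext_pos: "\<exists>e. \<forall>t. even_col t = p \<longrightarrow> t \<noteq> e \<longrightarrow>
    (\<exists>u. u \<noteq> f \<and> pos_adj u x \<and> pos_adj u t)"
proof -
  have *: "\<forall>d e::10. d \<noteq> 5 \<longrightarrow> d \<noteq> 2 * e \<longrightarrow>
      (\<exists>m. m \<noteq> e \<and> pos_adj m 0 \<and> pos_adj m d)"
    unfolding all_10 ex_10 pos_adj_def by simp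
  have E: "\<exists>u. u \<noteq> f \<and> pos_adj u x \<and> pos_adj u t" if t: "t \<noteq> x + 5" "t \<noteq> 2 * f - x" for t
  proof -
    have "t - x \<noteq> 5" "t - x \<noteq> 2 * (f - x)" using t by (auto simp: algebra_simps)
    then obtain m where m: "m \<noteq> f - x" "pos_adj m 0" "pos_adj m (t - x)" using * by blast
    have "m + x \<noteq> f" "pos_adj (m + x) x" "pos_adj (m + x) t"
      using m pos_adj_shift[of m x 0] pos_adj_shift[of m x "t - x"] by auto
    then show ?thesis by blast
  qed
  have "\<forall>x f. even_col (2 * f - x) \<longleftrightarrow> even_col x"
    unfolding all_10 even_col_def by simp
  then have "even_col (2 * f - x) \<noteq> even_col (x + 5)" by (simp add: even_col_shift)
  then show ?thesis using E by metis
qed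

text \<open>The situation of a semi vertex coloured \<open>u\<close>: \<open>f\<close> is the colour
  forbidden by its 2-neighbour, \<open>x\<close> and \<open>t\<close> are the colours of the other
  two neighbours. The signs are absorbed by \<open>flip\<close>, which keeps or reverses all
  parities at once.\<close>

lemma ext_vertex: "\<exists>e. \<forall>t. even_col t = p \<longrightarrow> t \<noteq> e \<longrightarrow>
    (\<exists>u. u \<noteq> f \<and> adj b1 u x \<and> adj b2 u t)"
proof -
  obtain e where e: "\<forall>t. even_col t = (b2 \<longleftrightarrow> p) \<longrightarrow> t \<noteq> e \<longrightarrow>
      (\<exists>u. u \<noteq> f \<and> pos_adj u (flip b1 x) \<and> pos_adj u t)"
    using ext_pos by metis
  show ?thesis unfolding adj_def
    by (rule exI[of _ "flip b2 e"]) (metis e flip_flip even_col_flip)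
qed

text \<open>The differences 4 and 6 keep parity while 3 and 7 change it, so each class contains two
  of the four neighbours of \<open>z\<close>.\<close>

lemma nbrs_parity: "\<exists>t1 t2. t1 \<noteq> t2 \<and> even_col t1 = p \<and> even_col t2 = p \<and> adj b t1 z \<and> adj b t2 z"
proof -
  have "\<forall>z. (\<exists>t1 t2. t1 \<noteq> t2 \<and> even_col t1 \<and> even_col t2 \<and> pos_adj t1 z \<and> pos_adj t2 z) \<and>
     (\<exists>t1 t2. t1 \<noteq> t2 \<and> \<not> even_col t1 \<and> \<not> even_col t2 \<and> pos_adj t1 z \<and> pos_adj t2 z)"
    unfolding all_10 ex_10 pos_adj_def even_col_def by simp
  then show ?thesis unfolding adj_def by metis
qed

text \<open>Each parity class contains two neighbours of \<open>z1\<close> and at least one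
  neighbour of \<open>z2\<close> that is not one of \<open>z1\<close>; three candidates survive two
  exclusions.\<close>

lemma nbrs_union:
  assumes "z1 \<noteq> z2"
  shows "\<exists>t. even_col t = p \<and> t \<noteq> e1 \<and> t \<noteq> e2 \<and> (adj b t z1 \<or> adj b t z2)"
proof -
  have *: "\<forall>d. d \<noteq> 0 \<longrightarrow>
      (\<exists>t. even_col t \<and> pos_adj t d \<and> \<not> pos_adj t 0) \<and> (\<exists>t. \<not> even_col t \<and> pos_adj t d \<and> \<not> pos_adj t 0)"
    unfolding all_10 ex_10 pos_adj_def even_col_def by simp
  have "\<exists>t. even_col t = q \<and> pos_adj t d \<and> \<not> pos_adj t c" if "c \<noteq> d" for q c d
  proof -
    have q: "\<exists>t. even_col t = r \<and> pos_adj t (d - c) \<and> \<not> pos_adj t 0" for r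
      using *[rule_format, of "d - c"] that by (cases r) auto
    obtain t where t: "even_col t = (even_col c \<longleftrightarrow> q)" "pos_adj t (d - c)" "\<not> pos_adj t 0" using q by blast
    have "\<forall>c d. even_col (c + d) \<longleftrightarrow> (even_col c \<longleftrightarrow> even_col d)" unfolding all_10 even_col_def by simp
    then have "even_col (t + c) = q" using t by auto
    moreover have "pos_adj (t + c) d" "\<not> pos_adj (t + c) c"
      using t pos_adj_shift[of t c "d - c"] pos_adj_shift[of t c 0] by auto
    ultimately show ?thesis by blast
  qed
  then obtain t3 where t3: "even_col t3 = p" "adj b t3 z2" "\<not> adj b t3 z1"
    unfolding adj_def using assms by (metis flip_eq_iff)
  obtain t1 t2 where "t1 \<noteq> t2" "even_col t1 = p" "even_col t2 = p" "adj b t1 z1" "adj b t2 z1"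
    using nbrs_parity by blast
  with t3 show ?thesis by metis
qed

lemma avoid3:
  assumes "distinct [a, b, c, d]"
  shows "\<exists>x \<in> {a, b, c, d}. x \<noteq> e1 \<and> x \<noteq> e2 \<and> x \<noteq> e3"
proof (rule ccontr)
  assume "\<not> ?thesis"
  then have "set [a, b, c, d] \<subseteq> set [e1, e2, e3]" by auto
  then have "card (set [a, b, c, d]) \<le> card (set [e1, e2, e3])" by (intro card_mono) auto
  also have "\<dots> \<le> 3" using card_length[of "[e1, e2, e3]"] by simp
  finally show False using distinct_card[OF assms] by simp
qed

lemma even_col_avoid3: "\<exists>t. even_col t = p \<and> t \<noteq> e1 \<and> t \<noteq> e2 \<and> t \<noteq> e3"
proof -
  have T: "\<exists>a b c d. distinct [a, b, c, d] \<and> even_col a \<and> even_col b \<and> even_col c \<and> even_col d"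
    by (rule exI[of _ 0], rule exI[of _ 2], rule exI[of _ 4], rule exI[of _ 6]) (simp add: even_col_def)
  have F: "\<exists>a b c d. distinct [a, b, c, d] \<and> \<not> even_col a \<and> \<not> even_col b \<and> \<not> even_col c \<and> \<not> even_col d"
    by (rule exI[of _ 1], rule exI[of _ 3], rule exI[of _ 5], rule exI[of _ 7]) (simp add: even_col_def)
  obtain a b c d where "distinct [a, b, c, d]" "even_col a = p" "even_col b = p" "even_col c = p" "even_col d = p"
    using T F by (cases p) auto
  then show ?thesis using avoid3[of a b c d e1 e2 e3] by auto
qed

lemma avoid4: "\<exists>c::10. c \<noteq> e1 \<and> c \<noteq> e2 \<and> c \<noteq> e3 \<and> c \<noteq> e4"
  by (metis even_col_avoid3)

lemma nbrs_avoid3: "\<exists>c. adj b c x \<and> c \<noteq> e1 \<and> c \<noteq> e2 \<and> c \<noteq> e3"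
proof -
  obtain t1 t2 where 1: "t1 \<noteq> t2" "even_col t1" "even_col t2" "adj b t1 x" "adj b t2 x"
    using nbrs_parity[of True b x] by auto
  obtain t3 t4 where 2: "t3 \<noteq> t4" "\<not> even_col t3" "\<not> even_col t4" "adj b t3 x" "adj b t4 x"
    using nbrs_parity[of False b x] by auto
  have "distinct [t1, t2, t3, t4]" using 1 2 by auto
  then show ?thesis using avoid3[of t1 t2 t3 t4 e1 e2 e3] 1 2 by auto
qed

text \<open>Every odd difference except 5 is the sum of an even and an odd element of {3, 4, 6, 7};
  the two orders of the sum give two common neighbours.\<close>

lemma common2_pos:
  assumes "even_col c \<noteq> even_col d" "d \<noteq> c + 5"
  shows "\<exists>m1 m2. m1 \<noteq> m2 \<and> pos_adj m1 c \<and> pos_adj m2 c \<and> pos_adj m1 d \<and> pos_adj m2 d"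
proof -
  have *: "\<forall>x \<in> {1, 3, 7, 9}. \<exists>m1 m2. m1 \<noteq> m2 \<and> pos_adj m1 0 \<and> pos_adj m2 0 \<and> pos_adj m1 x \<and> pos_adj m2 x"
    unfolding ex_10 pos_adj_def by simp
  have "\<forall>c d. even_col c \<noteq> even_col d \<longrightarrow> d - c \<in> {1, 3, 5, 7, 9}"
    unfolding all_10 even_col_def by simp
  then have "d - c \<in> {1, 3, 5, 7, 9}" using assms(1) by blast
  moreover have "d - c \<noteq> 5" using assms(2) by (auto simp: algebra_simps)
  ultimately have "d - c \<in> {1, 3, 7, 9}" by blast
  then obtain m1 m2 where m: "m1 \<noteq> m2" "pos_adj m1 0" "pos_adj m2 0" "pos_adj m1 (d - c)" "pos_adj m2 (d - c)"
    using * by blast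
  have "pos_adj (m1 + c) c" "pos_adj (m2 + c) c" "pos_adj (m1 + c) d" "pos_adj (m2 + c) d"
    using m pos_adj_shift[of m1 c 0] pos_adj_shift[of m2 c 0] pos_adj_shift[of m1 c "d - c"] pos_adj_shift[of m2 c "d - c"]
    by auto
  then show ?thesis using m(1) by (metis add_right_cancel)
qed

lemma common2:
  assumes "even_col d \<noteq> ((b1 \<longleftrightarrow> b2) \<longleftrightarrow> even_col c)" "d \<noteq> flip (b1 \<noteq> b2) c"
  shows "\<exists>m1 m2. m1 \<noteq> m2 \<and> adj b1 m1 c \<and> adj b1 m2 c \<and> adj b2 m1 d \<and> adj b2 m2 d"
proof -
  have "even_col (flip b1 c) \<noteq> even_col (flip b2 d)" using assms(1) by (auto simp: even_col_flip)
  moreover have "flip b2 d \<noteq> flip b1 c + 5"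
    using assms(2) by (cases b1; cases b2) (auto simp: flip_def five_five)
  ultimately show ?thesis unfolding adj_def by (rule common2_pos)
qed

text \<open>Colours for a vertex \<open>t\<close> with two semi neighbours \<open>u\<close> and
  \<open>v\<close> that share their 2-neighbour, whose constraint is the final inequality.\<close>

lemma four_cycle_pos:
  "\<exists>t u v. pos_adj t z \<and> pos_adj u t \<and> pos_adj u x \<and> pos_adj v t \<and> pos_adj v y \<and> u \<noteq> flip b v"
proof (cases "x = y")
  case True
  obtain t where t: "even_col t \<noteq> even_col x" "pos_adj t z" "t \<noteq> x + 5"
    using nbrs_parity[of "\<not> even_col x" True z] by (auto simp: adj_def flip_def)
  \<comment> \<open>With \<open>v\<close> fixed, the inequality forbids at most one of the two
    common neighbours of \<open>x\<close> and \<open>t\<close> as a colour \<open>u\<close>.\<close>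
  then show ?thesis using common2_pos[of x t] True by metis
next
  case False
  obtain t where t: "pos_adj t z" "t \<noteq> x + 5" "t \<noteq> y + 5"
    using nbrs_avoid3[of True z "x + 5" "y + 5"] by (auto simp: adj_def flip_def)
  obtain u v where uv: "pos_adj u x" "pos_adj u t" "pos_adj v y" "pos_adj v t"
    using t two_path_pos by metis
  show ?thesis
  proof (cases "b \<and> u = v")
    case True
    \<comment> \<open>If \<open>u = v\<close>, another colour \<open>w\<close> adjacent to
      \<open>t\<close> and to \<open>x\<close> or \<open>y\<close> replaces \<open>u\<close> or
      \<open>v\<close>. For the finite check everything is translated so that \<open>u\<close>
      becomes 0.\<close>
    have *: "\<forall>X \<in> {3,4,6,7}. \<forall>Y \<in> {3,4,6,7}. \<forall>T \<in> {3,4,6,7::10}. X \<noteq> Y \<longrightarrow>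
       (\<exists>w. w \<noteq> 0 \<and> pos_adj w T \<and> (pos_adj w X \<or> pos_adj w Y))"
      unfolding ex_10 pos_adj_def by simp
    have "x - u \<in> {3,4,6,7}" "y - u \<in> {3,4,6,7}" "t - u \<in> {3,4,6,7}"
      using uv True pos_adj_sym unfolding pos_adj_def by metis+
    then obtain w where w: "w \<noteq> 0" "pos_adj w (t - u)" "pos_adj w (x - u) \<or> pos_adj w (y - u)"
      using * False by (metis diff_eq_eq diff_add_cancel)
    have "pos_adj (w + u) t" "pos_adj (w + u) x \<or> pos_adj (w + u) y" "w + u \<noteq> u"
      using w pos_adj_shift[of w u "t - u"] pos_adj_shift[of w u "x - u"] pos_adj_shift[of w u "y - u"] by auto
    then show ?thesis using uv t True unfolding flip_def by metis
  next
    case F: False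
    \<comment> \<open>Both are adjacent to \<open>t\<close>, and by \<open>two_path_pos\<close>
      colours with a common neighbour never differ by 5.\<close>
    have "u \<noteq> v + 5" using uv adj_ne_flip two_path_pos
      by (metis five_five(2) pos_adj_shift pos_adj_sym)
    then show ?thesis using F uv t unfolding flip_def by metis
  qed
qed

lemma four_cycle:
  "\<exists>t u v. adj b1 t z \<and> adj b2 u t \<and> adj b3 u x \<and> adj b4 v t \<and> adj b5 v y \<and> u \<noteq> flip b v"
proof -
  \<comment> \<open>Flipping \<open>u\<close> and \<open>v\<close> absorbs the signs of their edges
    to \<open>t\<close>; the sign in the inequality is adjusted accordingly.\<close>
  obtain t u v where *: "pos_adj t (flip b1 z)" "pos_adj u t" "pos_adj u (flip b2 (flip b3 x))"
      "pos_adj v t" "pos_adj v (flip b4 (flip b5 y))" "u \<noteq> flip (b \<longleftrightarrow> (b2 \<longleftrightarrow> b4)) v"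
    using four_cycle_pos[of "flip b1 z" "flip b2 (flip b3 x)" "flip b4 (flip b5 y)"
        "b \<longleftrightarrow> (b2 \<longleftrightarrow> b4)"] by blast
  have "flip b2 u \<noteq> flip b (flip b4 v)"
    using *(6) by (cases b; cases b2; cases b4) (auto simp: flip_def five_five add.assoc)
  moreover have "adj b1 t z" "adj b2 (flip b2 u) t" "adj b4 (flip b4 v) t"
      "adj b3 (flip b2 u) x" "adj b5 (flip b4 v) y"
    using * unfolding adj_def pos_adj_flip by simp_all
  ultimately show ?thesis by blast
qed

lemma common2_adj:
  assumes "even_col d \<noteq> ((b1 \<longleftrightarrow> b2) \<longleftrightarrow> even_col c)" "adj b d c"
  shows "\<exists>m1 m2. m1 \<noteq> m2 \<and> adj b1 m1 c \<and> adj b1 m2 c \<and> adj b2 m1 d \<and> adj b2 m2 d"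
  using common2[OF assms(1)] adj_ne_flip[OF assms(2)] by blast

text \<open>For \<open>z = 0\<close> the parity of \<open>t\<close> is chosen so that
  \<open>u\<close> has two candidates. If the colour found for \<open>v\<close> is \<open>g\<close>,
  shifting all colours by 5 moves it off \<open>g\<close>, and \<open>u\<close> still has two
  candidates.\<close>

lemma two_triangles:
  "\<exists>z t u v. adj b t z \<and> adj b1 u z \<and> adj b2 u t \<and> adj b3 v z \<and> adj b4 v t \<and> u \<noteq> f \<and> v \<noteq> g"
proof -
  obtain t where t: "even_col t = (\<not> ((b1 \<longleftrightarrow> b2) \<longleftrightarrow> even_col 0))" "adj b t 0" using nbrs_parity by blast
  obtain u1 u2 where u: "u1 \<noteq> u2" "adj b1 u1 0" "adj b1 u2 0" "adj b2 u1 t" "adj b2 u2 t"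
    using common2_adj[of t b1 b2 0 b] t by auto
  obtain v where v: "adj b3 v 0" "adj b4 v t" using two_path adj_ne_flip[OF t(2)] by metis
  show ?thesis
  proof (cases "v = g")
    case False
    then show ?thesis using t u v by metis
  next
    case True
    then have "v + 5 \<noteq> g" by (metis flip_def five_five(2) even_col_shift)
    moreover have "\<exists>u. u \<noteq> f \<and> adj b1 u (0 + 5) \<and> adj b2 u (t + 5)"
      using u adj_shift by (metis add_right_cancel)
    ultimately show ?thesis using t v adj_shift by metis
  qed
qed

text \<open>Two neighbours of \<open>q\<close> have the parity for which \<open>common2\<close>
  applies with \<open>p\<close>, and at most one of them is the excluded copy of
  \<open>p\<close>.\<close>

lemma path_common2:
  "\<exists>a z1 z2. adj b a q \<and> z1 \<noteq> z2 \<and> adj b1 z1 p \<and> adj b1 z2 p \<and> adj b2 z1 a \<and> adj b2 z2 a"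
proof -
  obtain a where "even_col a = (\<not> ((b1 \<longleftrightarrow> b2) \<longleftrightarrow> even_col p))" "adj b a q" "a \<noteq> flip (b1 \<noteq> b2) p"
    using nbrs_parity by metis
  then show ?thesis using common2[of a b1 b2 p] by metis
qed

lemma flip_neq_commute: "flip (b1 \<noteq> b2) c = flip (b2 \<noteq> b1) c"
proof -
  have "(b1 \<noteq> b2) = (b2 \<noteq> b1)" by blast
  then show ?thesis by (rule arg_cong)
qed

section \<open>Colourings of signed graphs\<close>

locale sgraph =
  fixes V :: "'a set" and E :: "'a set set" and s :: "'a set \<Rightarrow> int"
  assumes signed: "signed_graph V E s"
begin

definition nbrs :: "'a \<Rightarrow> 'a set" where
  "nbrs v = {u. {u, v} \<in> E}"

definition deg :: "'a \<Rightarrow> nat" where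
  "deg v = card (nbrs v)"

definition positive :: "'a \<Rightarrow> 'a \<Rightarrow> bool" where
  "positive u v \<longleftrightarrow> s {u, v} = 1"

text \<open>Only edges with both ends in \<open>W\<close> count; a partial colouring is a total
  function with arbitrary values outside \<open>W\<close>.\<close>

definition valid :: "'a set \<Rightarrow> ('a \<Rightarrow> 10) \<Rightarrow> bool" where
  "valid W \<phi> \<longleftrightarrow> (\<forall>u\<in>W. \<forall>v\<in>W. v \<in> nbrs u \<longrightarrow> adj (positive u v) (\<phi> u) (\<phi> v))"

lemma finite_V: "finite V"
  using signed unfolding signed_graph_def by (rule conjunct1)

lemma edge_cases: assumes "e \<in> E" obtains u v where "u \<in> V" "v \<in> V" "u \<noteq> v" "e = {u, v}"
proof -
  have "\<forall>e\<in>E. \<exists>u v. u \<in> V \<and> v \<in> V \<and> u \<noteq> v \<and> e = {u, v}"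
    using signed unfolding signed_graph_def by (elim conjE)
  from bspec[OF this assms] show ?thesis by (elim exE conjE) (rule that)
qed

lemma nbrs_symD: "u \<in> nbrs v \<Longrightarrow> v \<in> nbrs u"
  unfolding nbrs_def by (simp add: insert_commute[of u v])

lemma nbrs_V: assumes "u \<in> nbrs v" shows "u \<in> V" "v \<in> V" "u \<noteq> v"
proof -
  have "{u, v} \<in> E" using assms by (simp add: nbrs_def)
  then obtain a b where "a \<in> V" "b \<in> V" "a \<noteq> b" "{u, v} = {a, b}" by (rule edge_cases)
  then have "u = a \<and> v = b \<or> u = b \<and> v = a" by (simp add: doubleton_eq_iff)
  then show "u \<in> V" "v \<in> V" "u \<noteq> v" using \<open>a \<in> V\<close> \<open>b \<in> V\<close> \<open>a \<noteq> b\<close> by blast+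
qed

lemma nbrs_subset: "nbrs v \<subseteq> V"
  by (rule subsetI) (rule nbrs_V(1))

lemma nbrs_irrefl [simp]: "v \<notin> nbrs v"
  by (auto dest: nbrs_V(3))

lemma finite_nbrs [simp]: "finite (nbrs v)"
  using nbrs_subset finite_V by (rule finite_subset)

lemma positive_sym: "positive u v = positive v u"
  unfolding positive_def by (simp add: insert_commute[of u v])

lemma valid_insert:
  assumes "valid W \<phi>" "v \<notin> W" "\<And>y. y \<in> nbrs v \<Longrightarrow> y \<in> W \<Longrightarrow> adj (positive v y) c (\<phi> y)"
  shows "valid (insert v W) (\<phi>(v := c))"
  unfolding valid_def
proof (intro ballI impI)
  fix a b assume ab: "a \<in> insert v W" "b \<in> insert v W" "b \<in> nbrs a"
  then have "a \<noteq> b" using nbrs_V(3) by blast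
  then consider "a = v" "b \<in> W" | "b = v" "a \<in> W" | "a \<in> W" "b \<in> W" using ab by blast
  then show "adj (positive a b) ((\<phi>(v := c)) a) ((\<phi>(v := c)) b)"
  proof cases
    case 1
    then have "adj (positive v b) c (\<phi> b)" using assms(3) ab(3) by blast
    then show ?thesis using 1 \<open>a \<noteq> b\<close> by simp
  next
    case 2
    then have "adj (positive v a) c (\<phi> a)" using assms(3) nbrs_symD[OF ab(3)] by blast
    then have "adj (positive a v) (\<phi> a) c" using positive_sym[of v a] adj_sym[of "positive v a" c] by simp
    then show ?thesis using 2 \<open>a \<noteq> b\<close> by simp
  next
    case 3
    then have "a \<noteq> v" "b \<noteq> v" using assms(2) by blast+
    moreover have "adj (positive a b) (\<phi> a) (\<phi> b)" using assms(1) 3 ab(3) unfolding valid_def by blast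
    ultimately show ?thesis by simp
  qed
qed

lemma handshake: "(\<Sum>v\<in>V. deg v) = 2 * card E"
proof -
  have "E \<subseteq> Pow V"
  proof
    fix e assume "e \<in> E"
    then obtain a b where "a \<in> V" "b \<in> V" "e = {a, b}" by (rule edge_cases)
    then show "e \<in> Pow V" by simp
  qed
  then have finE: "finite E" by (rule finite_subset) (simp add: finite_V)
  have D: "deg v = card {e\<in>E. v \<in> e}" for v
  proof -
    have "inj_on (\<lambda>u. {u, v}) (nbrs v)" by (rule inj_onI) (metis doubleton_eq_iff)
    moreover have "(\<lambda>u. {u, v}) ` nbrs v = {e \<in> E. v \<in> e}"
    proof (intro equalityI subsetI)
      fix e assume e: "e \<in> {e \<in> E. v \<in> e}"
      then have "e \<in> E" by simp
      then obtain a b where "e = {a, b}" by (rule edge_cases)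
      then have "e = {a, v} \<or> e = {b, v}" using e by (cases "v = a") (simp_all add: insert_commute)
      then show "e \<in> (\<lambda>u. {u, v}) ` nbrs v" using \<open>e \<in> E\<close> unfolding nbrs_def by blast
    next
      fix e assume "e \<in> (\<lambda>u. {u, v}) ` nbrs v"
      then show "e \<in> {e \<in> E. v \<in> e}" unfolding nbrs_def by blast
    qed
    ultimately have "bij_betw (\<lambda>u. {u, v}) (nbrs v) {e\<in>E. v \<in> e}" by (rule bij_betw_imageI)
    then show ?thesis unfolding deg_def by (rule bij_betw_same_card)
  qed
  have "(\<Sum>v\<in>V. deg v) = (\<Sum>v\<in>V. card {e\<in>E. v \<in> e})" by (simp only: D)
  also have "\<dots> = (\<Sum>v\<in>V. \<Sum>e\<in>E. if v \<in> e then 1 else 0)"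
    by (intro sum.cong[OF HOL.refl]) (simp only: card_eq_sum sum.inter_filter[OF finE])
  also have "\<dots> = (\<Sum>e\<in>E. \<Sum>v\<in>V. if v \<in> e then 1 else 0)" by (rule sum.swap)
  also have "\<dots> = (\<Sum>e\<in>E. 2)"
  proof (rule sum.cong[OF HOL.refl])
    fix e assume "e \<in> E"
    then obtain a b where ab: "a \<in> V" "b \<in> V" "a \<noteq> b" "e = {a, b}" by (rule edge_cases)
    then have "{v \<in> V. v \<in> e} = {a, b}" by blast
    then have "card {v \<in> V. v \<in> e} = 2" using ab(3) by simp
    then show "(\<Sum>v\<in>V. if v \<in> e then 1 else 0) = (2::nat)"
      by (simp only: card_eq_sum sum.inter_filter[OF finite_V])
  qed
  finally show ?thesis by simp
qed

end

section \<open>Minimal counterexamples\<close>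

text \<open>\<open>sparse\<close> is the bound 20/7 on the average degree in integer form; its
  premise excludes the empty graph, for which \<open>0 < 0\<close> would be claimed.\<close>

locale critical = sgraph +
  assumes not_colourable: "\<not> valid V \<phi>"
    and proper_colourable: "W \<subset> V \<Longrightarrow> \<exists>\<phi>. valid W \<phi>"
    and sparse: "V \<noteq> {} \<Longrightarrow> 7 * card E < 10 * card V"
begin

lemma V_ne: "V \<noteq> {}"
  using not_colourable by (auto simp: valid_def)

lemma deg_ge_2: assumes "v \<in> V" shows "deg v \<ge> 2"
proof (rule ccontr)
  assume "\<not> deg v \<ge> 2"
  then have "card (nbrs v) \<le> 1" by (simp add: deg_def)
  then obtain y where y: "nbrs v \<subseteq> {y}"
    by (metis One_nat_def card_1_singletonE card_le_Suc0_iff_eq finite_nbrs is_singletonI' is_singleton_def subsetI singletonI empty_subsetI)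
  obtain \<phi> where \<phi>: "valid (V - {v}) \<phi>" using proper_colourable[of "V - {v}"] assms by blast
  obtain c where "adj (positive v y) c (\<phi> y)" using nbrs_avoid3 by blast
  then have "valid (insert v (V - {v})) (\<phi>(v := c))"
    using y by (intro valid_insert[OF \<phi>]) auto
  then show False using not_colourable assms by (simp add: insert_absorb)
qed

lemma nbrs_light: assumes "deg w = 2" "v \<in> nbrs w" shows "\<exists>y. y \<noteq> v \<and> nbrs w = {v, y}"
proof -
  obtain a b where "nbrs w = {a, b}" "a \<noteq> b" using assms(1) unfolding deg_def card_2_iff by blast
  then show ?thesis using assms(2) by (cases "v = a") auto
qed

lemma no_adjacent_light: assumes "deg v = 2" "w \<in> nbrs v" shows "deg w \<noteq> 2"
proof
  assume w: "deg w = 2"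
  obtain x where x: "x \<noteq> w" "nbrs v = {w, x}" using nbrs_light[OF assms] by blast
  obtain y where y: "y \<noteq> v" "nbrs w = {v, y}" using nbrs_light[OF w nbrs_symD[OF assms(2)]] by blast
  have vw: "v \<in> V" "w \<in> V" "v \<noteq> w" using nbrs_V assms(2) by auto
  obtain \<phi> where \<phi>: "valid (V - {v, w}) \<phi>" using proper_colourable[of "V - {v, w}"] vw by blast
  obtain m n where mn: "adj (positive v x) m (\<phi> x)" "adj (positive v w) m n" "adj (positive w y) n (\<phi> y)"
    using three_path by blast
  have 1: "valid (insert v (V - {v, w})) (\<phi>(v := m))"
    using x mn by (intro valid_insert[OF \<phi>]) auto
  have "valid (insert w (insert v (V - {v, w}))) (\<phi>(v := m, w := n))"
    using y mn vw adj_sym[of "positive v w" m n] positive_sym[of v w] by (intro valid_insert[OF 1]) auto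
  moreover have "insert w (insert v (V - {v, w})) = V" using vw by auto
  ultimately show False using not_colourable by simp
qed

section \<open>Colourings of the vertices of degree at least 3\<close>

definition core :: "'a set" where "core = {v \<in> V. deg v \<noteq> 2}"

text \<open>Meaningful only if \<open>w\<close> has degree 2 and \<open>v\<close> is one of its neighbours.\<close>

definition other_nbr :: "'a \<Rightarrow> 'a \<Rightarrow> 'a" where
  "other_nbr w v = (THE y. y \<in> nbrs w \<and> y \<noteq> v)"

lemma nbrs_other: assumes "deg w = 2" "v \<in> nbrs w" shows "nbrs w = {v, other_nbr w v}" "other_nbr w v \<noteq> v"
proof -
  from nbrs_light[OF assms] obtain y where y: "y \<noteq> v" "nbrs w = {v, y}" by (elim exE conjE)
  have "other_nbr w v = y" unfolding other_nbr_def y(2) using y(1) by (intro the_equality) auto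
  then show "nbrs w = {v, other_nbr w v}" "other_nbr w v \<noteq> v" using y by simp_all
qed

lemma other_nbr_core: assumes "deg w = 2" "v \<in> nbrs w" shows "other_nbr w v \<in> core"
proof -
  have "other_nbr w v \<in> nbrs w" using nbrs_other[OF assms] by simp
  then show ?thesis using no_adjacent_light[OF assms(1)] nbrs_V(1) unfolding core_def by simp
qed

lemma nbr_of_light_core: assumes "deg w = 2" "v \<in> nbrs w" shows "v \<in> core"
  using no_adjacent_light[OF assms] nbrs_V(1)[OF assms(2)] unfolding core_def by simp

text \<open>A vertex \<open>w\<close> of degree 2 can be coloured exactly if its neighbour \<open>v\<close> avoids one colour determined
  by the other neighbour. So vertices of degree 2 may be left out of the colouring and kept as
  constraints between vertices of \<open>core\<close>.\<close>

definition blocked :: "'a \<Rightarrow> 'a \<Rightarrow> ('a \<Rightarrow> 10) \<Rightarrow> 10" where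
  "blocked w v \<phi> = flip (positive w v \<noteq> positive w (other_nbr w v)) (\<phi> (other_nbr w v))"

definition good :: "'a set \<Rightarrow> ('a \<Rightarrow> 10) \<Rightarrow> bool" where
  "good W \<phi> \<longleftrightarrow> valid W \<phi> \<and>
     (\<forall>v\<in>W. \<forall>w\<in>nbrs v. deg w = 2 \<longrightarrow> other_nbr w v \<in> W \<longrightarrow> \<phi> v \<noteq> blocked w v \<phi>)"

text \<open>As \<open>S\<close> lies in \<open>core\<close>, a colouring of \<open>V - S\<close>
  includes all 2-vertices, and their colours are the middle vertices in
  \<open>two_path\<close>.\<close>

lemma good_ex: assumes "S \<subseteq> core" "S \<noteq> {}" shows "\<exists>\<phi>. good (core - S) \<phi>"
proof -
  have "V - S \<subset> V" using assms unfolding core_def by blast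
  then obtain \<phi> where \<phi>: "valid (V - S) \<phi>" using proper_colourable by blast
  have "valid (core - S) \<phi>" using \<phi> unfolding valid_def core_def by blast
  moreover have "\<phi> v \<noteq> blocked w v \<phi>"
    if v: "v \<in> core - S" and w: "w \<in> nbrs v" "deg w = 2" and o: "other_nbr w v \<in> core - S" for v w
  proof -
    have vw: "v \<in> nbrs w" using w(1) by (rule nbrs_symD)
    have "w \<in> V - S" using w assms(1) nbrs_V(1) unfolding core_def by blast
    moreover have "v \<in> V - S" "other_nbr w v \<in> V - S" using v o unfolding core_def by auto
    moreover have "other_nbr w v \<in> nbrs w" using nbrs_other[OF w(2) vw] by auto
    ultimately have "adj (positive w (other_nbr w v)) (\<phi> w) (\<phi> (other_nbr w v))" "adj (positive w v) (\<phi> w) (\<phi> v)"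
      using \<phi> vw unfolding valid_def by blast+
    then have "\<phi> v \<noteq> flip (positive w (other_nbr w v) \<noteq> positive w v) (\<phi> (other_nbr w v))" using two_path by blast
    then show ?thesis unfolding blocked_def flip_neq_commute[of "positive w v"] .
  qed
  ultimately show ?thesis unfolding good_def by blast
qed

text \<open>By \<open>two_path\<close> each 2-vertex can be coloured from its neighbours; no two
  2-vertices are adjacent, so these choices are independent and would colour
  \<open>V\<close>.\<close>

lemma not_good_core: "\<not> good core \<phi>"
proof
  assume g: "good core \<phi>"
  have "\<exists>c. \<forall>y\<in>nbrs w. adj (positive w y) c (\<phi> y)" if w: "w \<in> V" "deg w = 2" for w
  proof -
    have "nbrs w \<noteq> {}" using w(2) unfolding deg_def by auto
    then obtain v where v: "v \<in> nbrs w" by blast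
    have "\<phi> v \<noteq> blocked w v \<phi>"
      using g nbrs_symD[OF v] w(2) other_nbr_core[OF w(2) v] nbr_of_light_core[OF w(2) v] unfolding good_def by blast
    then obtain c where "adj (positive w (other_nbr w v)) c (\<phi> (other_nbr w v))" "adj (positive w v) c (\<phi> v)"
      unfolding blocked_def flip_neq_commute[of "positive w v"] two_path[symmetric] by blast
    then show ?thesis using nbrs_other(1)[OF w(2) v] by auto
  qed
  then obtain h where h: "\<And>w y. w \<in> V \<Longrightarrow> deg w = 2 \<Longrightarrow> y \<in> nbrs w \<Longrightarrow> adj (positive w y) (h w) (\<phi> y)"
    by metis
  have "valid V (\<lambda>v. if deg v = 2 then h v else \<phi> v)"
    unfolding valid_def
  proof (intro ballI impI)
    fix u v assume uv: "u \<in> V" "v \<in> V" "v \<in> nbrs u"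
    consider "deg u = 2" "deg v \<noteq> 2" | "deg v = 2" "deg u \<noteq> 2" | "deg u \<noteq> 2" "deg v \<noteq> 2"
      using no_adjacent_light uv by blast
    then show "adj (positive u v) (if deg u = 2 then h u else \<phi> u) (if deg v = 2 then h v else \<phi> v)"
    proof cases
      case 1 then show ?thesis using h uv by simp
    next
      case 2
      then show ?thesis using h[of v u] uv nbrs_symD[OF uv(3)] adj_sym[of "positive v u" "h v"] positive_sym[of u v]
        by simp
    next
      case 3 then show ?thesis using g uv unfolding good_def valid_def core_def by simp
    qed
  qed
  then show False using not_colourable by blast
qed

lemma good_insert:
  assumes g: "good W \<phi>" and v: "v \<notin> W"
    and 1: "\<And>y. y \<in> nbrs v \<Longrightarrow> y \<in> W \<Longrightarrow> adj (positive v y) c (\<phi> y)"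
    and 2: "\<And>w. w \<in> nbrs v \<Longrightarrow> deg w = 2 \<Longrightarrow> other_nbr w v \<in> W \<Longrightarrow> c \<noteq> blocked w v \<phi>"
  shows "good (insert v W) (\<phi>(v := c))"
  unfolding good_def
proof (intro conjI ballI impI)
  show "valid (insert v W) (\<phi>(v := c))"
    using g v 1 unfolding good_def by (intro valid_insert) auto
next
  fix u w assume u: "u \<in> insert v W" and w: "w \<in> nbrs u" "deg w = 2" and o: "other_nbr w u \<in> insert v W"
  have uw: "u \<in> nbrs w" using w(1) by (rule nbrs_symD)
  have ow: "other_nbr w u \<in> nbrs w" "other_nbr w u \<noteq> u" "nbrs w = {u, other_nbr w u}" using nbrs_other[OF w(2) uw] by auto
  have oo: "other_nbr w (other_nbr w u) = u" using nbrs_other[OF w(2) ow(1)] ow by auto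
  consider "u = v" "other_nbr w u \<in> W" | "u \<in> W" "other_nbr w u = v" | "u \<in> W" "other_nbr w u \<in> W"
    using u o ow(2) by auto
  then show "(\<phi>(v := c)) u \<noteq> blocked w u (\<phi>(v := c))"
  proof cases
    case 1
    then show ?thesis using 2[of w] w v by (auto simp: blocked_def)
  next
    case c2: 2
    \<comment> \<open>The same constraint seen from its other end: \<open>flip\<close> is an
      involution, so the inequality is symmetric.\<close>
    then have "c \<noteq> blocked w v \<phi>" using 2[of w] w nbrs_symD[OF ow(1)] oo by simp
    then have "c \<noteq> flip (positive w v \<noteq> positive w u) (\<phi> u)" using c2 oo unfolding blocked_def by simp
    then have "\<phi> u \<noteq> flip (positive w u \<noteq> positive w v) c"
      unfolding flip_neq_commute[of "positive w u"] by auto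
    then show ?thesis using c2 v by (auto simp: blocked_def)
  next
    case 3
    then show ?thesis using g w v by (auto simp: good_def blocked_def)
  qed
qed

lemma blocked_upd [simp]:
  "blocked w u (\<phi>(v := c)) = (if other_nbr w u = v then flip (positive w u \<noteq> positive w v) c else blocked w u \<phi>)"
  by (auto simp: blocked_def)

lemma nbr_core: assumes "x \<in> nbrs u" "deg x \<noteq> 2" shows "x \<in> core"
  using assms nbrs_V(1) unfolding core_def by blast

lemma deg3_nbrs: assumes "deg t = 3" "u \<in> nbrs t" "v \<in> nbrs t" "u \<noteq> v"
  obtains z where "nbrs t = {u, v, z}" "z \<noteq> u" "z \<noteq> v"
proof -
  have "card (nbrs t - {u, v}) = 1"
    using assms unfolding deg_def by (simp add: card_Diff_subset)
  then obtain z where z: "nbrs t - {u, v} = {z}" by (rule card_1_singletonE)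
  have "nbrs t = {u, v, z}" using z assms(2,3) by blast
  moreover have "z \<noteq> u" "z \<noteq> v" using z by blast+
  ultimately show ?thesis by (rule that)
qed

lemma deg3_nbrs': assumes "deg t = 3" "u \<in> nbrs t"
  obtains v z where "nbrs t = {u, v, z}" "v \<noteq> u" "z \<noteq> u" "z \<noteq> v"
proof -
  have "card (nbrs t - {u}) = 2" using assms unfolding deg_def by simp
  then obtain v where "v \<in> nbrs t" "v \<noteq> u" by (metis DiffE card.empty empty_iff ex_in_conv insertI1 zero_neq_numeral)
  then show ?thesis using deg3_nbrs[OF assms(1,2), of v] that by metis
qed

section \<open>Reducible configurations\<close>

text \<open>Each 2-neighbour costs one colour: at most four of ten are lost if \<open>y\<close> has
  degree 2, otherwise at most three of the four next to the colour of \<open>y\<close>. The vertices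
  \<open>w1\<close>, \<open>w2\<close>, \<open>w3\<close> may coincide, which covers 3-vertices with
  two 2-neighbours.\<close>

lemma one_nonlight_nbr_reducible:
  assumes v: "v \<in> core" "nbrs v \<subseteq> {w1, w2, w3, y}" and w: "deg w1 = 2" "deg w2 = 2" "deg w3 = 2"
  shows False
proof -
  obtain \<phi> where \<phi>: "good (core - {v}) \<phi>" using good_ex[of "{v}"] v(1) by blast
  have "\<exists>c. c \<noteq> blocked w1 v \<phi> \<and> c \<noteq> blocked w2 v \<phi> \<and> c \<noteq> blocked w3 v \<phi> \<and>
      (if deg y = 2 then c \<noteq> blocked y v \<phi> else adj (positive v y) c (\<phi> y))"
  proof (cases "deg y = 2")
    case True then show ?thesis using avoid4[of "blocked w1 v \<phi>" "blocked w2 v \<phi>" "blocked w3 v \<phi>" "blocked y v \<phi>"] by simp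
  next
    case False then show ?thesis using nbrs_avoid3[of "positive v y" "\<phi> y" "blocked w1 v \<phi>" "blocked w2 v \<phi>" "blocked w3 v \<phi>"] by auto
  qed
  then obtain c where c: "c \<noteq> blocked w1 v \<phi>" "c \<noteq> blocked w2 v \<phi>" "c \<noteq> blocked w3 v \<phi>"
     "if deg y = 2 then c \<noteq> blocked y v \<phi> else adj (positive v y) c (\<phi> y)" by blast
  have "good (insert v (core - {v})) (\<phi>(v := c))"
  proof (rule good_insert[OF \<phi>])
    fix a assume a: "a \<in> nbrs v" "a \<in> core - {v}"
    then have "deg a \<noteq> 2" unfolding core_def by simp
    then have "a = y" using a(1) v(2) w by auto
    then show "adj (positive v a) c (\<phi> a)" using c(4) \<open>deg a \<noteq> 2\<close> by simp
  next
    fix a assume a: "a \<in> nbrs v" "deg a = 2"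
    then have "a \<in> {w1, w2, w3, y}" using v(2) by blast
    then show "c \<noteq> blocked a v \<phi>" using c a(2) by (auto split: if_splits)
  qed simp
  then show False using not_good_core v(1) by (simp add: insert_absorb)
qed

section \<open>Semi and plain vertices\<close>

definition semi_nbrs :: "'a \<Rightarrow> 'a \<Rightarrow> 'a \<Rightarrow> 'a \<Rightarrow> bool" where
  "semi_nbrs u w x t \<longleftrightarrow> nbrs u = {w, x, t} \<and> w \<noteq> x \<and> w \<noteq> t \<and> x \<noteq> t \<and> deg w = 2 \<and> deg x \<noteq> 2 \<and> deg t \<noteq> 2"

definition semi :: "'a \<Rightarrow> bool" where
  "semi u \<longleftrightarrow> deg u = 3 \<and> (\<exists>w\<in>nbrs u. deg w = 2)"

definition plain :: "'a \<Rightarrow> bool" where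
  "plain u \<longleftrightarrow> deg u = 3 \<and> (\<forall>w\<in>nbrs u. deg w \<noteq> 2)"

lemma semi_nbrs_sym: "semi_nbrs u w x t \<Longrightarrow> semi_nbrs u w t x"
  unfolding semi_nbrs_def by auto

lemma semi_nbrsD: assumes "semi_nbrs u w x t"
  shows "deg u = 3" "u \<in> core" "x \<in> core" "t \<in> core" "u \<in> nbrs t" "u \<in> nbrs x" "u \<in> nbrs w" "w \<in> nbrs u" "x \<in> nbrs u" "t \<in> nbrs u"
    "deg w = 2" "u \<noteq> x" "u \<noteq> t" "x \<noteq> t" "semi u"
proof -
  note * = assms[unfolded semi_nbrs_def]
  show d: "deg u = 3" using * unfolding deg_def by auto
  show n: "w \<in> nbrs u" "x \<in> nbrs u" "t \<in> nbrs u" using * by auto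
  then show "u \<in> nbrs t" "u \<in> nbrs x" "u \<in> nbrs w" using nbrs_symD by auto
  then show "u \<in> core" using d nbrs_V(1) unfolding core_def by auto
  show "x \<in> core" "t \<in> core" using * n nbr_core by auto
  show "u \<noteq> x" "u \<noteq> t" using n by auto
  show "deg w = 2" "x \<noteq> t" using * by auto
  then show "semi u" using d n unfolding semi_def by auto
qed

lemma deg3_one_light: assumes "deg u = 3" "w \<in> nbrs u" "deg w = 2" "x \<in> nbrs u" "deg x = 2" shows "x = w"
proof (rule ccontr)
  assume "x \<noteq> w"
  then obtain z where "nbrs u = {w, x, z}" using deg3_nbrs[OF assms(1,2,4)] by metis
  moreover have "u \<in> core" using assms(1) nbrs_V(2)[OF assms(2)] unfolding core_def by simp
  ultimately show False using one_nonlight_nbr_reducible[of u w x x z] assms by auto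
qed

lemma semi_obtain_nbrs: assumes "semi u" "t \<in> nbrs u" "deg t \<noteq> 2"
  obtains w x where "semi_nbrs u w x t"
proof -
  obtain w where w: "deg u = 3" "w \<in> nbrs u" "deg w = 2" using assms(1) unfolding semi_def by blast
  then have "w \<noteq> t" using assms(3) by auto
  obtain x where x: "nbrs u = {w, t, x}" "x \<noteq> w" "x \<noteq> t"
    using deg3_nbrs[OF w(1,2) assms(2) \<open>w \<noteq> t\<close>] by metis
  have "x \<in> nbrs u" using x by simp
  then have "deg x \<noteq> 2" using deg3_one_light[OF w, of x] x(2) by auto
  then have "semi_nbrs u w x t" using x w assms(3) \<open>w \<noteq> t\<close> unfolding semi_nbrs_def by auto
  then show ?thesis by (rule that)
qed

lemma semi_nbrs_light: assumes "semi_nbrs u w x t" "a \<in> nbrs u" "deg a = 2" shows "a = w"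
  using assms unfolding semi_nbrs_def by auto

lemma semi_nbrs_other: assumes "semi_nbrs u w x t"
  shows "other_nbr w u \<in> core" "other_nbr w u \<noteq> u" "w \<in> nbrs (other_nbr w u)"
proof -
  note * = semi_nbrsD(7,11)[OF assms]
  show "other_nbr w u \<in> core" using other_nbr_core * by blast
  show "other_nbr w u \<noteq> u" using nbrs_other * by blast
  have "other_nbr w u \<in> nbrs w" using nbrs_other(1)[OF *(2,1)] by simp
  then show "w \<in> nbrs (other_nbr w u)" by (rule nbrs_symD)
qed

text \<open>Hence colouring \<open>v\<close> leaves the constraint that \<open>w\<close> puts on
  \<open>u\<close> unchanged.\<close>

lemma semi_nbrs_other_plain: assumes "semi_nbrs u w x t" "\<forall>a\<in>nbrs v. deg a \<noteq> 2" shows "other_nbr w u \<noteq> v"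
  using semi_nbrs_other(3)[OF assms(1)] semi_nbrsD(11)[OF assms(1)] assms(2) by auto

lemma semi_nbrs_other_semi: assumes "semi_nbrs u w x t" "semi_nbrs v w' x' t'" "w \<noteq> w'" shows "other_nbr w u \<noteq> v"
proof
  assume "other_nbr w u = v"
  then have "w \<in> nbrs v" using semi_nbrs_other(3)[OF assms(1)] by simp
  then show False using semi_nbrs_light[OF assms(2)] semi_nbrsD(11)[OF assms(1)] assms(3) by simp
qed

lemma good_insert_semi:
  assumes "good W \<phi>" "semi_nbrs u w x t" "u \<notin> W"
    and "x \<in> W \<Longrightarrow> adj (positive u x) c (\<phi> x)" "t \<in> W \<Longrightarrow> adj (positive u t) c (\<phi> t)"
    and "other_nbr w u \<in> W \<Longrightarrow> c \<noteq> blocked w u \<phi>" and "w \<notin> W"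
  shows "good (insert u W) (\<phi>(u := c))"
proof (rule good_insert[OF assms(1,3)])
  fix y assume "y \<in> nbrs u" "y \<in> W"
  then show "adj (positive u y) c (\<phi> y)" using assms(2,4,5,7) unfolding semi_nbrs_def by auto
next
  fix a assume "a \<in> nbrs u" "deg a = 2" "other_nbr a u \<in> W"
  then show "c \<noteq> blocked a u \<phi>" using semi_nbrs_light[OF assms(2)] assms(6) by auto
qed

lemma good_insert_plain:
  assumes "good W \<phi>" "t \<notin> W" "\<forall>a\<in>nbrs t. deg a \<noteq> 2"
    and "\<And>y. y \<in> nbrs t \<Longrightarrow> y \<in> W \<Longrightarrow> adj (positive t y) c (\<phi> y)"
  shows "good (insert t W) (\<phi>(t := c))"
  using assms by (intro good_insert) auto

section \<open>Adjacent semi vertices, and semi neighbours of a plain vertex\<close>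

lemma no_adjacent_semi: assumes u: "semi_nbrs u w x v" and v: "semi_nbrs v w' y u" shows False
proof -
  note ud = semi_nbrsD[OF u] and vd = semi_nbrsD[OF v]
  let ?W = "core - {u, v}"
  obtain \<phi> where \<phi>: "good ?W \<phi>" using good_ex[of "{u, v}"] ud vd by blast
  let ?ok = "\<lambda>c. \<exists>a. a \<noteq> blocked w u \<phi> \<and> adj (positive u x) a (\<phi> x) \<and> adj (positive u v) a c"
  obtain e1 where e1: "\<forall>c. even_col c = True \<longrightarrow> c \<noteq> e1 \<longrightarrow> ?ok c" using ext_vertex by blast
  obtain e2 where e2: "\<forall>c. even_col c = False \<longrightarrow> c \<noteq> e2 \<longrightarrow> ?ok c" using ext_vertex by blast
  \<comment> \<open>Four colours are adjacent to that of \<open>y\<close>, and three are to be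
    avoided: the exception of \<open>u\<close> in each parity class and the colour blocked by
    \<open>w'\<close>.\<close>
  obtain c where c: "adj (positive v y) c (\<phi> y)" "c \<noteq> e1" "c \<noteq> e2" "c \<noteq> blocked w' v \<phi>" using nbrs_avoid3 by blast
  have "?ok c" using e1 e2 c by (cases "even_col c") auto
  then obtain a where a: "a \<noteq> blocked w u \<phi>" "adj (positive u x) a (\<phi> x)" "adj (positive u v) a c" by blast
  have wn: "w \<notin> core" "w' \<notin> core" using ud(11) vd(11) unfolding core_def by auto
  have 1: "good (insert v ?W) (\<phi>(v := c))"
    using c wn by (intro good_insert_semi[OF \<phi> v]) auto
  \<comment> \<open>If \<open>u\<close> and \<open>v\<close> share their 2-neighbour, its constraint
    compares \<open>a\<close> with a copy of \<open>c\<close>, and \<open>adj_ne_flip\<close>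
    applies.\<close>
  have "good (insert u (insert v ?W)) (\<phi>(v := c, u := a))"
    using a ud vd wn adj_ne_flip[OF a(3)] by (intro good_insert_semi[OF 1 u]) auto
  moreover have "insert u (insert v ?W) = core" using ud vd by auto
  ultimately show False using not_good_core by simp
qed

lemma semi_nonadj: assumes "semi_nbrs u w x t" "semi v" shows "x \<noteq> v" "t \<noteq> v"
proof -
  have A: False if T: "semi_nbrs u w x v" for x
  proof -
    have "u \<in> nbrs v" "deg u \<noteq> 2" using semi_nbrsD[OF T] by auto
    then obtain w' y where "semi_nbrs v w' y u" by (rule semi_obtain_nbrs[OF assms(2)])
    then show False using no_adjacent_semi[OF T] by blast
  qed
  show "x \<noteq> v" "t \<noteq> v" using A assms(1) semi_nbrs_sym by blast+
qed

lemma light_notin_core: assumes "semi_nbrs u w x t" shows "w \<notin> core"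
  using semi_nbrsD(11)[OF assms] unfolding core_def by simp

text \<open>A common 2-neighbour closes a 4-cycle through \<open>t\<close>, \<open>u\<close> and
  \<open>v\<close>, and \<open>four_cycle\<close> supplies colours for these three.\<close>

lemma light_distinct:
  assumes t: "plain t" and u: "semi_nbrs u w x t" and v: "semi_nbrs v w' y t" and uv: "u \<noteq> v"
  shows "w \<noteq> w'"
proof
  assume "w = w'"
  then have v: "semi_nbrs v w y t" using v by simp
  note ud = semi_nbrsD[OF u] and vd = semi_nbrsD[OF v]
  have t3: "deg t = 3" and tl: "\<forall>a\<in>nbrs t. deg a \<noteq> 2" using t unfolding plain_def by auto
  obtain z where z: "nbrs t = {u, v, z}" "z \<noteq> u" "z \<noteq> v" using deg3_nbrs[OF t3 ud(5) vd(5) uv] by metis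
  let ?W = "core - {t, u, v}"
  obtain \<phi> where \<phi>: "good ?W \<phi>" using good_ex[of "{t, u, v}"] ud vd by blast
  have ou: "other_nbr w u = v"
  proof -
    have "nbrs w = {u, other_nbr w u}" using nbrs_other[OF ud(11,7)] by simp
    then show ?thesis using vd(7) uv by auto
  qed
  have ov: "other_nbr w v = u"
  proof -
    have "nbrs w = {v, other_nbr w v}" using nbrs_other[OF vd(11,7)] by simp
    then show ?thesis using ud(7) uv by auto
  qed
  obtain ct cu cv where c: "adj (positive t z) ct (\<phi> z)" "adj (positive u t) cu ct" "adj (positive u x) cu (\<phi> x)"
     "adj (positive v t) cv ct" "adj (positive v y) cv (\<phi> y)" "cu \<noteq> flip (positive w u \<noteq> positive w v) cv"
    using four_cycle by blast
  have xy: "x \<noteq> v" "y \<noteq> u" using semi_nonadj(1)[OF u vd(15)] semi_nonadj(1)[OF v ud(15)] by auto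
  have 1: "good (insert t ?W) (\<phi>(t := ct))"
    using c z by (intro good_insert_plain[OF \<phi> _ tl]) auto
  have 2: "good (insert v (insert t ?W)) (\<phi>(t := ct, v := cv))"
    using c ud vd uv ov light_notin_core[OF v] by (intro good_insert_semi[OF 1 v]) auto
  have "good (insert u (insert v (insert t ?W))) (\<phi>(t := ct, v := cv, u := cu))"
    using c ud vd xy uv ou light_notin_core[OF u] by (intro good_insert_semi[OF 2 u]) auto
  moreover have "insert u (insert v (insert t ?W)) = core" using ud vd by auto
  ultimately show False using not_good_core by simp
qed

lemma no_three_semi:
  assumes t: "plain t" and a: "semi_nbrs a w1 x t" and b: "semi_nbrs b w2 y t" and c: "semi_nbrs c w3 z t"
    and d: "a \<noteq> b" "a \<noteq> c" "b \<noteq> c"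
  shows False
proof -
  note ad = semi_nbrsD[OF a] and bd = semi_nbrsD[OF b] and cd = semi_nbrsD[OF c]
  have t3: "deg t = 3" and tl: "\<forall>a\<in>nbrs t. deg a \<noteq> 2" using t unfolding plain_def by auto
  have w: "w1 \<noteq> w2" "w1 \<noteq> w3" "w2 \<noteq> w3"
    using light_distinct[OF t a b] light_distinct[OF t a c] light_distinct[OF t b c] d by auto
  obtain c' where "nbrs t = {a, b, c'}" using deg3_nbrs[OF t3 ad(5) bd(5) d(1)] by metis
  then have nt: "nbrs t = {a, b, c}" using cd(5) d by auto
  have n: "x \<noteq> b" "x \<noteq> c" "y \<noteq> a" "y \<noteq> c" "z \<noteq> a" "z \<noteq> b"
    using semi_nonadj(1)[OF a bd(15)] semi_nonadj(1)[OF a cd(15)] semi_nonadj(1)[OF b ad(15)]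
      semi_nonadj(1)[OF b cd(15)] semi_nonadj(1)[OF c ad(15)] semi_nonadj(1)[OF c bd(15)] by auto
  let ?W = "core - {t, a, b, c}"
  obtain \<phi> where \<phi>: "good ?W \<phi>" using good_ex[of "{t, a, b, c}"] ad bd cd by blast
  obtain e1 where e1: "\<forall>t'. even_col t' = True \<longrightarrow> t' \<noteq> e1 \<longrightarrow>
      (\<exists>u. u \<noteq> blocked w1 a \<phi> \<and> adj (positive a x) u (\<phi> x) \<and> adj (positive a t) u t')"
    using ext_vertex by blast
  obtain e2 where e2: "\<forall>t'. even_col t' = True \<longrightarrow> t' \<noteq> e2 \<longrightarrow>
      (\<exists>u. u \<noteq> blocked w2 b \<phi> \<and> adj (positive b y) u (\<phi> y) \<and> adj (positive b t) u t')"
    using ext_vertex by blast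
  obtain e3 where e3: "\<forall>t'. even_col t' = True \<longrightarrow> t' \<noteq> e3 \<longrightarrow>
      (\<exists>u. u \<noteq> blocked w3 c \<phi> \<and> adj (positive c z) u (\<phi> z) \<and> adj (positive c t) u t')"
    using ext_vertex by blast
  \<comment> \<open>There are five even colours, and each of the three semi neighbours excludes at
    most one.\<close>
  obtain ct where ct: "even_col ct = True" "ct \<noteq> e1" "ct \<noteq> e2" "ct \<noteq> e3" using even_col_avoid3 by blast
  obtain ca where ca: "ca \<noteq> blocked w1 a \<phi>" "adj (positive a x) ca (\<phi> x)" "adj (positive a t) ca ct" using e1 ct by blast
  obtain cb where cb: "cb \<noteq> blocked w2 b \<phi>" "adj (positive b y) cb (\<phi> y)" "adj (positive b t) cb ct" using e2 ct by blast
  obtain cc where cc: "cc \<noteq> blocked w3 c \<phi>" "adj (positive c z) cc (\<phi> z)" "adj (positive c t) cc ct" using e3 ct by blast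
  \<comment> \<open>The blocked colours were read off \<open>\<phi>\<close>; they persist because no
    2-neighbour leads to a vertex coloured earlier in the order \<open>t\<close>, \<open>a\<close>,
    \<open>b\<close>, \<open>c\<close>.\<close>
  have o: "other_nbr w1 a \<noteq> t" "other_nbr w2 b \<noteq> t" "other_nbr w3 c \<noteq> t"
      "other_nbr w2 b \<noteq> a" "other_nbr w3 c \<noteq> a" "other_nbr w3 c \<noteq> b"
    using semi_nbrs_other_plain[OF a tl] semi_nbrs_other_plain[OF b tl] semi_nbrs_other_plain[OF c tl]
      semi_nbrs_other_semi[OF b a] semi_nbrs_other_semi[OF c a] semi_nbrs_other_semi[OF c b] w by auto
  have 1: "good (insert t ?W) (\<phi>(t := ct))"
    using nt by (intro good_insert_plain[OF \<phi> _ tl]) auto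
  have 2: "good (insert a (insert t ?W)) (\<phi>(t := ct, a := ca))"
    using ca ad o light_notin_core[OF a] by (intro good_insert_semi[OF 1 a]) auto
  have 3: "good (insert b (insert a (insert t ?W))) (\<phi>(t := ct, a := ca, b := cb))"
    using cb ad bd o d n light_notin_core[OF b] by (intro good_insert_semi[OF 2 b]) auto
  have "good (insert c (insert b (insert a (insert t ?W)))) (\<phi>(t := ct, a := ca, b := cb, c := cc))"
    using cc ad bd cd o d n light_notin_core[OF c] by (intro good_insert_semi[OF 3 c]) auto
  moreover have "insert c (insert b (insert a (insert t ?W))) = core" using ad bd cd by auto
  ultimately show False using not_good_core by simp
qed

text \<open>Two different colours of \<open>z\<close> suffice to colour \<open>t\<close>, \<open>u\<close> and \<open>v\<close>: the four colours that \<open>u\<close> and \<open>v\<close>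
  exclude at \<open>t\<close> comprise two of each parity, while two colours of \<open>z\<close> leave three of each parity.\<close>

lemma bad_extend:
  assumes \<phi>: "good W \<phi>" and t: "plain t" and u: "semi_nbrs u w x t" and v: "semi_nbrs v w' y t" and uv: "u \<noteq> v"
    and nt: "nbrs t = {u, v, z}" "z \<noteq> u" "z \<noteq> v" and z: "plain z"
    and W: "t \<notin> W" "u \<notin> W" "v \<notin> W" "z \<notin> W" "x \<in> W" "y \<in> W"
    and z1: "good (insert z W) (\<phi>(z := z1))" and z2: "good (insert z W) (\<phi>(z := z2))" and zz: "z1 \<noteq> z2"
    and WH: "W \<subseteq> core"
  obtains \<phi>' where "good (insert u (insert v (insert t (insert z W)))) \<phi>'"
    "\<forall>a\<in>W. \<phi>' a = \<phi> a" "\<phi>' z = z1 \<or> \<phi>' z = z2"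
proof -
  note ud = semi_nbrsD[OF u] and vd = semi_nbrsD[OF v]
  have tl: "\<forall>a\<in>nbrs t. deg a \<noteq> 2" and zl: "\<forall>a\<in>nbrs z. deg a \<noteq> 2" using t z unfolding plain_def by auto
  have w: "w \<noteq> w'" using light_distinct[OF t u v uv] .
  obtain e1 where e1: "\<forall>c. even_col c = True \<longrightarrow> c \<noteq> e1 \<longrightarrow>
      (\<exists>a. a \<noteq> blocked w u \<phi> \<and> adj (positive u x) a (\<phi> x) \<and> adj (positive u t) a c)"
    using ext_vertex by blast
  obtain e2 where e2: "\<forall>c. even_col c = True \<longrightarrow> c \<noteq> e2 \<longrightarrow>
      (\<exists>a. a \<noteq> blocked w' v \<phi> \<and> adj (positive v y) a (\<phi> y) \<and> adj (positive v t) a c)"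
    using ext_vertex by blast
  obtain ct where ct: "even_col ct = True" "ct \<noteq> e1" "ct \<noteq> e2" "adj (positive t z) ct z1 \<or> adj (positive t z) ct z2"
    using nbrs_union[OF zz] by blast
  \<comment> \<open>Which of its two colours \<open>z\<close> takes is decided only after
    \<open>t\<close> has been coloured.\<close>
  then obtain cz where cz: "cz = z1 \<or> cz = z2" "adj (positive t z) ct cz" by blast
  obtain cu where cu: "cu \<noteq> blocked w u \<phi>" "adj (positive u x) cu (\<phi> x)" "adj (positive u t) cu ct" using e1 ct by blast
  obtain cv where cv: "cv \<noteq> blocked w' v \<phi>" "adj (positive v y) cv (\<phi> y)" "adj (positive v t) cv ct" using e2 ct by blast
  have o: "other_nbr w u \<noteq> t" "other_nbr w' v \<noteq> t" "other_nbr w u \<noteq> z" "other_nbr w' v \<noteq> z" "other_nbr w u \<noteq> v"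
    using semi_nbrs_other_plain[OF u tl] semi_nbrs_other_plain[OF v tl] semi_nbrs_other_plain[OF u zl] semi_nbrs_other_plain[OF v zl]
      semi_nbrs_other_semi[OF u v w] by auto
  have tz: "t \<noteq> z" using nt nbrs_irrefl[of t] by auto
  have zH: "z \<in> core" using nt tl nbr_core[of z t] by auto
  have g1: "good (insert z W) (\<phi>(z := cz))" using cz z1 z2 by auto
  have g2: "good (insert t (insert z W)) (\<phi>(z := cz, t := ct))"
    using W cz nt tz by (intro good_insert_plain[OF g1 _ tl]) auto
  have wn: "w \<notin> insert v (insert t (insert z W))" "w' \<notin> insert t (insert z W)"
    using light_notin_core[OF u] light_notin_core[OF v] WH ud vd zH by blast+
  have g3: "good (insert v (insert t (insert z W))) (\<phi>(z := cz, t := ct, v := cv))"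
    using W cv vd o nt tz wn by (intro good_insert_semi[OF g2 v]) auto
  have g4: "good (insert u (insert v (insert t (insert z W)))) (\<phi>(z := cz, t := ct, v := cv, u := cu))"
    using W cu ud vd o nt tz uv wn by (intro good_insert_semi[OF g3 u]) auto
  show ?thesis by (rule that[OF g4]) (use W cz nt tz ud vd in auto)
qed

text \<open>\<open>bad_extend\<close> does not fit, as the outer neighbour of \<open>u\<close> is
  \<open>z\<close> itself. Parity gives \<open>u\<close> two candidates instead.\<close>

lemma triangle_reducible:
  assumes z: "plain z" and t: "plain t" and nz: "nbrs z = {t, u, p}" "p \<noteq> t" "p \<noteq> u"
    and nt: "nbrs t = {u, v, z}" "z \<noteq> u" "z \<noteq> v" and uv: "u \<noteq> v"
    and u: "semi_nbrs u w z t" and v: "semi_nbrs v w' y t"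
  shows False
proof -
  note ud = semi_nbrsD[OF u] and vd = semi_nbrsD[OF v]
  have tl: "\<forall>a\<in>nbrs t. deg a \<noteq> 2" and zl: "\<forall>a\<in>nbrs z. deg a \<noteq> 2" using t z unfolding plain_def by auto
  have w: "w \<noteq> w'" using light_distinct[OF t u v uv] .
  have tz: "t \<noteq> z" using ud by auto
  have o: "other_nbr w u \<noteq> t" "other_nbr w' v \<noteq> t" "other_nbr w u \<noteq> z" "other_nbr w' v \<noteq> z" "other_nbr w u \<noteq> v"
    using semi_nbrs_other_plain[OF u tl] semi_nbrs_other_plain[OF v tl] semi_nbrs_other_plain[OF u zl] semi_nbrs_other_plain[OF v zl]
      semi_nbrs_other_semi[OF u v w] by auto
  have pz: "p \<noteq> z" using nz nbrs_irrefl[of z] by auto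
  have pd: "deg p \<noteq> 2" using nz zl by auto
  let ?W = "core - {z, t, u, v}"
  obtain \<phi> where \<phi>: "good ?W \<phi>" using good_ex[of "{z, t, u, v}"] ud vd by blast
  have "\<exists>cz ct cu cv. (p \<noteq> v \<longrightarrow> adj (positive z p) cz (\<phi> p)) \<and> adj (positive t z) ct cz \<and>
     adj (positive v t) cv ct \<and> (y \<noteq> z \<longrightarrow> adj (positive v y) cv (\<phi> y)) \<and> (y = z \<longrightarrow> adj (positive v z) cv cz) \<and>
     cv \<noteq> blocked w' v \<phi> \<and> adj (positive u z) cu cz \<and> adj (positive u t) cu ct \<and> cu \<noteq> blocked w u \<phi>"
  proof (cases "y = z")
    case True
    \<comment> \<open>Apart from 2-vertices, \<open>z\<close>, \<open>t\<close>, \<open>u\<close>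
      and \<open>v\<close> then have no neighbours outside these four.\<close>
    have "v \<in> nbrs z" using True vd(6) by simp
    then have "p = v" using nz vd uv by auto
    obtain cz ct cu cv where "adj (positive t z) ct cz" "adj (positive u z) cu cz" "adj (positive u t) cu ct"
      "adj (positive v z) cv cz" "adj (positive v t) cv ct" "cu \<noteq> blocked w u \<phi>" "cv \<noteq> blocked w' v \<phi>"
      using two_triangles by blast
    then show ?thesis using True \<open>p = v\<close> by blast
  next
    case False
    obtain cz where cz: "adj (positive z p) cz (\<phi> p)" using nbrs_avoid3 by blast
    \<comment> \<open>With this parity \<open>ct\<close> has two common neighbours with
      \<open>cz\<close>, up to signs; within it \<open>v\<close> excludes at most one colour of
      \<open>t\<close>.\<close>
    let ?q = "\<not> ((positive u z \<longleftrightarrow> positive u t) \<longleftrightarrow> even_col cz)"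
    obtain e where e: "\<forall>c. even_col c = ?q \<longrightarrow> c \<noteq> e \<longrightarrow>
        (\<exists>a. a \<noteq> blocked w' v \<phi> \<and> adj (positive v y) a (\<phi> y) \<and> adj (positive v t) a c)"
      using ext_vertex by blast
    obtain t1 t2 where "t1 \<noteq> t2" "even_col t1 = ?q" "even_col t2 = ?q" "adj (positive t z) t1 cz" "adj (positive t z) t2 cz"
      using nbrs_parity by blast
    then obtain ct where ct: "even_col ct = ?q" "adj (positive t z) ct cz" "ct \<noteq> e" by (cases "t1 = e") auto
    obtain cv where cv: "cv \<noteq> blocked w' v \<phi>" "adj (positive v y) cv (\<phi> y)" "adj (positive v t) cv ct" using e ct by blast
    have "even_col ct \<noteq> ((positive u z \<longleftrightarrow> positive u t) \<longleftrightarrow> even_col cz)" using ct(1) by simp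
    from common2_adj[OF this ct(2)] obtain m1 m2 where "m1 \<noteq> m2" "adj (positive u z) m1 cz" "adj (positive u z) m2 cz"
      "adj (positive u t) m1 ct" "adj (positive u t) m2 ct" by blast
    then obtain cu where "adj (positive u z) cu cz" "adj (positive u t) cu ct" "cu \<noteq> blocked w u \<phi>"
      by (cases "m1 = blocked w u \<phi>") auto
    then show ?thesis using cz ct cv False by blast
  qed
  then obtain cz ct cu cv where c: "p \<noteq> v \<longrightarrow> adj (positive z p) cz (\<phi> p)" "adj (positive t z) ct cz"
     "adj (positive v t) cv ct" "y \<noteq> z \<longrightarrow> adj (positive v y) cv (\<phi> y)" "y = z \<longrightarrow> adj (positive v z) cv cz"
     "cv \<noteq> blocked w' v \<phi>" "adj (positive u z) cu cz" "adj (positive u t) cu ct" "cu \<noteq> blocked w u \<phi>" by blast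
  have g1: "good (insert z ?W) (\<phi>(z := cz))"
    using c nz by (intro good_insert_plain[OF \<phi> _ zl]) auto
  have g2: "good (insert t (insert z ?W)) (\<phi>(z := cz, t := ct))"
    using c nt tz ud vd by (intro good_insert_plain[OF g1 _ tl]) auto
  have g3: "good (insert v (insert t (insert z ?W))) (\<phi>(z := cz, t := ct, v := cv))"
    using c vd o nt tz uv light_notin_core[OF v] ud by (intro good_insert_semi[OF g2 v]) auto
  have "good (insert u (insert v (insert t (insert z ?W)))) (\<phi>(z := cz, t := ct, v := cv, u := cu))"
    using c ud vd o nt tz uv light_notin_core[OF u] by (intro good_insert_semi[OF g3 u]) auto
  moreover have "insert u (insert v (insert t (insert z ?W))) = core" using ud vd by auto
  ultimately show False using not_good_core by simp
qed

text \<open>Next to \<open>p\<close> and \<open>a\<close>, two colours remain possible for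
  \<open>z\<close>, and these suffice for \<open>bad_extend\<close> on the side of
  \<open>t\<close>.\<close>

lemma semi_bad_reducible:
  assumes z: "plain z" and t: "plain t" and nz: "nbrs z = {t, a, p}" "p \<noteq> t" "p \<noteq> a" "a \<noteq> t"
    and nt: "nbrs t = {u, v, z}" "z \<noteq> u" "z \<noteq> v" and uv: "u \<noteq> v"
    and u: "semi_nbrs u w x t" and v: "semi_nbrs v w' y t" and a: "semi_nbrs a w'' q z"
    and d: "a \<noteq> u" "a \<noteq> v" "p \<noteq> u" "p \<noteq> v"
  shows False
proof -
  note ud = semi_nbrsD[OF u] and vd = semi_nbrsD[OF v] and ad = semi_nbrsD[OF a]
  have tl: "\<forall>a\<in>nbrs t. deg a \<noteq> 2" and zl: "\<forall>a\<in>nbrs z. deg a \<noteq> 2" using t z unfolding plain_def by auto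
  have tz: "t \<noteq> z" using nt nbrs_irrefl[of t] by auto
  have pz: "p \<noteq> z" using nz nbrs_irrefl[of z] by auto
  have pH: "p \<in> core" using nz zl nbr_core[of p z] by auto
  have an: "a \<notin> nbrs t" using nt d ad by auto
  have un: "u \<notin> nbrs z" "v \<notin> nbrs z" using nz d ud vd by auto
  have x: "x \<noteq> z" "x \<noteq> a" "x \<noteq> v" using un(1) ud(6) semi_nonadj(1)[OF u ad(15)] semi_nonadj(1)[OF u vd(15)] by auto
  have y: "y \<noteq> z" "y \<noteq> a" "y \<noteq> u" using un(2) vd(6) semi_nonadj(1)[OF v ad(15)] semi_nonadj(1)[OF v ud(15)] by auto
  have q: "q \<noteq> t" "q \<noteq> u" "q \<noteq> v" using an ad(6) semi_nonadj(1)[OF a ud(15)] semi_nonadj(1)[OF a vd(15)] by auto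
  let ?W = "core - {z, t, u, v, a}"
  obtain \<phi> where \<phi>: "good ?W \<phi>" using good_ex[of "{z, t, u, v, a}"] ud vd ad by blast
  have xW: "x \<in> ?W" "y \<in> ?W" "p \<in> ?W" "q \<in> ?W" using x y q ud vd ad nz pH pz d by auto
  have o: "other_nbr w'' a \<noteq> t" "other_nbr w'' a \<noteq> z" "other_nbr w'' a \<noteq> a"
    using semi_nbrs_other_plain[OF a tl] semi_nbrs_other_plain[OF a zl] semi_nbrs_other(2)[OF a] by auto
  show False
  proof (cases "other_nbr w'' a \<in> {u, v}")
    case True
    \<comment> \<open>\<open>a\<close> has its 2-neighbour in common with \<open>u\<close> or \<open>v\<close>, so it is coloured before them, and in such a
      way that \<open>z\<close> keeps two colours.\<close>
    obtain ca z1 z2 where c: "adj (positive a q) ca (\<phi> q)" "z1 \<noteq> z2" "adj (positive z p) z1 (\<phi> p)" "adj (positive z p) z2 (\<phi> p)"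
       "adj (positive z a) z1 ca" "adj (positive z a) z2 ca"
      using path_common2[of "positive a q" "\<phi> q" "positive z p" "\<phi> p" "positive z a"] by blast
    let ?W1 = "insert a ?W"
    have g1: "good ?W1 (\<phi>(a := ca))"
      using c True light_notin_core[OF a] by (intro good_insert_semi[OF \<phi> a]) auto
    have gz: "good (insert z ?W1) (\<phi>(a := ca, z := cz))" if "cz = z1 \<or> cz = z2" for cz
      using c that nz ad xW by (intro good_insert_plain[OF g1 _ zl]) auto
    obtain \<phi>' where "good (insert u (insert v (insert t (insert z ?W1)))) \<phi>'"
      by (rule bad_extend[OF g1 t u v uv nt z _ _ _ _ _ _ gz[of z1] gz[of z2] c(2)])
        (use xW ud vd ad d tz nt nz in auto)
    moreover have "insert u (insert v (insert t (insert z ?W1))) = core" using ud vd ad by auto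
    ultimately show False using not_good_core by simp
  next
    case False
    let ?ok = "\<lambda>c. \<exists>b. b \<noteq> blocked w'' a \<phi> \<and> adj (positive a q) b (\<phi> q) \<and> adj (positive a z) b c"
    obtain e1 where e1: "\<forall>c. even_col c = True \<longrightarrow> c \<noteq> e1 \<longrightarrow> ?ok c" using ext_vertex by blast
    obtain e2 where e2: "\<forall>c. even_col c = False \<longrightarrow> c \<noteq> e2 \<longrightarrow> ?ok c" using ext_vertex by blast
    have "\<exists>c. even_col c = r \<and> c \<noteq> e \<and> adj (positive z p) c (\<phi> p)" for r e
      using nbrs_parity[of r "positive z p" "\<phi> p"] by metis
    \<comment> \<open>Two colours of each parity are adjacent to that of \<open>p\<close>, and
      \<open>a\<close> excludes at most one in each class; \<open>z\<close> keeps an even and an odd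
      one.\<close>
    then obtain z1 z2 where c: "even_col z1 = True" "z1 \<noteq> e1" "adj (positive z p) z1 (\<phi> p)"
        "even_col z2 = False" "z2 \<noteq> e2" "adj (positive z p) z2 (\<phi> p)" by metis
    have zz: "z1 \<noteq> z2" using c by auto
    have ok: "?ok z1" "?ok z2" using c e1 e2 by auto
    have gz: "good (insert z ?W) (\<phi>(z := cz))" if "cz = z1 \<or> cz = z2" for cz
      using c that nz ad by (intro good_insert_plain[OF \<phi> _ zl]) auto
    obtain \<phi>' where p': "good (insert u (insert v (insert t (insert z ?W)))) \<phi>'"
        "\<forall>b\<in>?W. \<phi>' b = \<phi> b" "\<phi>' z = z1 \<or> \<phi>' z = z2"
      by (rule bad_extend[OF \<phi> t u v uv nt z _ _ _ _ _ _ gz[of z1] gz[of z2] zz])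
        (use xW ud vd ad d tz nt nz in auto)
    obtain ca where ca: "ca \<noteq> blocked w'' a \<phi>" "adj (positive a q) ca (\<phi> q)" "adj (positive a z) ca (\<phi>' z)"
      using ok p'(3) by auto
    \<comment> \<open>\<open>a\<close> is coloured last: \<open>bad_extend\<close> kept the colours
      on \<open>?W\<close>, so the blocked colour read off \<open>\<phi>\<close> is still the right
      one.\<close>
    have "other_nbr w'' a \<in> ?W" using False o semi_nbrs_other(1)[OF a] by auto
    then have "blocked w'' a \<phi>' = blocked w'' a \<phi>" using p'(2) unfolding blocked_def by simp
    moreover have "\<phi>' q = \<phi> q" using p'(2) xW by blast
    ultimately have "good (insert a (insert u (insert v (insert t (insert z ?W))))) (\<phi>'(a := ca))"
      using ca ad d nz light_notin_core[OF a] ud vd by (intro good_insert_semi[OF p'(1) a]) auto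
    moreover have "insert a (insert u (insert v (insert t (insert z ?W)))) = core" using ud vd ad by auto
    ultimately show False using not_good_core by simp
  qed
qed

section \<open>Plain vertices with bad neighbours\<close>

definition bad :: "'a \<Rightarrow> bool" where
  "bad t \<longleftrightarrow> plain t \<and> (\<exists>u\<in>nbrs t. \<exists>v\<in>nbrs t. u \<noteq> v \<and> semi u \<and> semi v)"

lemma badE:
  assumes "bad t" "z \<in> nbrs t" "\<not> semi z"
  obtains u v w x w' y where "nbrs t = {u, v, z}" "u \<noteq> v" "z \<noteq> u" "z \<noteq> v" "semi_nbrs u w x t" "semi_nbrs v w' y t"
proof -
  obtain u v where uv: "u \<in> nbrs t" "v \<in> nbrs t" "u \<noteq> v" "semi u" "semi v" and t: "deg t = 3"
    using assms(1) unfolding bad_def plain_def by blast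
  obtain z' where z': "nbrs t = {u, v, z'}" using deg3_nbrs[OF t uv(1,2,3)] by metis
  have "z \<noteq> u" "z \<noteq> v" using uv assms(3) by auto
  then have "z' = z" using z' assms(2) by auto
  have d: "deg t \<noteq> 2" using t by simp
  obtain w x where "semi_nbrs u w x t" using semi_obtain_nbrs[OF uv(4) nbrs_symD[OF uv(1)] d] by metis
  moreover obtain w' y where "semi_nbrs v w' y t" using semi_obtain_nbrs[OF uv(5) nbrs_symD[OF uv(2)] d] by metis
  ultimately show ?thesis using that z' \<open>z' = z\<close> \<open>z \<noteq> u\<close> \<open>z \<noteq> v\<close> uv(3) by metis
qed

text \<open>If a semi neighbour of \<open>t\<close> is adjacent to \<open>z\<close>, there is a
  triangle; otherwise the vertices are distinct as \<open>semi_bad_reducible\<close>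
  requires.\<close>

lemma no_semi_bad:
  assumes z: "plain z" and t: "bad t" "t \<in> nbrs z" and a: "semi a" "a \<in> nbrs z"
  shows False
proof -
  have tp: "plain t" using t unfolding bad_def by simp
  have zs: "\<not> semi z" using z unfolding plain_def semi_def by auto
  have ts: "\<not> semi t" using tp unfolding plain_def semi_def by auto
  obtain u v w x w' y where T: "nbrs t = {u, v, z}" "u \<noteq> v" "z \<noteq> u" "z \<noteq> v" "semi_nbrs u w x t" "semi_nbrs v w' y t"
    using badE[OF t(1) nbrs_symD[OF t(2)] zs] by metis
  have d: "deg z = 3" "deg z \<noteq> 2" using z unfolding plain_def by auto
  have at: "t \<noteq> a" using ts a by auto
  have tz: "t \<noteq> z" using nbrs_V(3)[OF t(2)] .
  have tri: False if b: "b \<in> nbrs z" "semi_nbrs b w1 x1 t" "semi_nbrs c w2 y1 t" "nbrs t = {b, c, z}" "b \<noteq> c" "z \<noteq> b" "z \<noteq> c"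
    for b c w1 x1 w2 y1
  proof -
    have "z \<in> nbrs b" using nbrs_symD[OF b(1)] .
    then have "x1 = z" using b(2) d(2) tz unfolding semi_nbrs_def by auto
    have "b \<noteq> t" using semi_nbrsD[OF b(2)] by auto
    obtain p where p: "nbrs z = {t, b, p}" "p \<noteq> t" "p \<noteq> b"
      using deg3_nbrs[OF d(1) t(2) b(1)] \<open>b \<noteq> t\<close> by metis
    show False by (rule triangle_reducible[OF z tp p b(4,6,7,5) _ b(3)]) (use b(2) \<open>x1 = z\<close> in simp)
  qed
  show False
  proof (cases "u \<in> nbrs z \<or> v \<in> nbrs z")
    case True
    have "nbrs t = {v, u, z}" using T(1) by auto
    then show False using True tri[OF _ T(5,6,1,2,3,4)] tri[OF _ T(6,5)] T by metis
  next
    case False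
    obtain p where p: "nbrs z = {t, a, p}" "p \<noteq> t" "p \<noteq> a" using deg3_nbrs[OF d(1) t(2) a(2) at] by metis
    obtain w'' q where a': "semi_nbrs a w'' q z" using semi_obtain_nbrs[OF a(1) nbrs_symD[OF a(2)] d(2)] by metis
    have "a \<noteq> u" "a \<noteq> v" "p \<noteq> u" "p \<noteq> v" using False p(1) a(2) by auto
    then show False
      using semi_bad_reducible[OF z tp p at[symmetric] T(1,3,4,2,5,6) a'] by blast
  qed
qed

lemma no_two_bad:
  assumes z: "plain z" and t: "bad t" "t \<in> nbrs z" and t': "bad t'" "t' \<in> nbrs z" and tt: "t \<noteq> t'"
  shows False
proof -
  have tp: "plain t" "plain t'" using t t' unfolding bad_def by auto
  have zs: "\<not> semi z" using z unfolding plain_def semi_def by auto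
  \<comment> \<open>By \<open>no_semi_bad\<close> the semi vertices on both sides stay away from
    \<open>z\<close>, which also makes \<open>p\<close> different from them.\<close>
  have zn: "b \<notin> nbrs z" if "semi b" for b using no_semi_bad[OF z t that] by blast
  have tl: "\<forall>a\<in>nbrs t. deg a \<noteq> 2" and tl': "\<forall>a\<in>nbrs t'. deg a \<noteq> 2" and zl: "\<forall>a\<in>nbrs z. deg a \<noteq> 2"
    and d: "deg z = 3" using tp z unfolding plain_def by auto
  obtain u v w x wv y where T: "nbrs t = {u, v, z}" "u \<noteq> v" "z \<noteq> u" "z \<noteq> v" "semi_nbrs u w x t" "semi_nbrs v wv y t"
    using badE[OF t(1) nbrs_symD[OF t(2)] zs] by metis
  obtain u' v' w' x' wv' y' where T': "nbrs t' = {u', v', z}" "u' \<noteq> v'" "z \<noteq> u'" "z \<noteq> v'" "semi_nbrs u' w' x' t'" "semi_nbrs v' wv' y' t'"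
    using badE[OF t'(1) nbrs_symD[OF t'(2)] zs] by metis
  obtain p where p: "nbrs z = {t, t', p}" "p \<noteq> t" "p \<noteq> t'" using deg3_nbrs[OF d t(2) t'(2) tt] by metis
  note ud = semi_nbrsD[OF T(5)] and vd = semi_nbrsD[OF T(6)] and ud' = semi_nbrsD[OF T'(5)] and vd' = semi_nbrsD[OF T'(6)]
  have tz: "t \<noteq> z" "t' \<noteq> z" "p \<noteq> z" using nbrs_irrefl[of z] p(1) by auto
  have pl: "t \<noteq> b" "t' \<noteq> b" "z \<noteq> b" if "semi b" for b
    using that tp z unfolding semi_def plain_def by auto
  note pl = pl[OF ud(15)] pl[OF vd(15)] pl[OF ud'(15)] pl[OF vd'(15)]
  note zn' = zn[OF ud(15)] zn[OF vd(15)] zn[OF ud'(15)] zn[OF vd'(15)]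
  have pH: "p \<in> core" using p(1) zl nbr_core[of p z] by auto
  have zH: "z \<in> core" using T(1) tl nbr_core[of z t] by auto
  let ?S = "{z, t, t', u, v, u', v'}"
  let ?W = "core - ?S"
  have pW: "p \<in> ?W" using pH zn' p tz by auto
  obtain \<phi> where \<phi>: "good ?W \<phi>" using good_ex[of ?S] zH ud vd ud' vd' by blast
  \<comment> \<open>A colour of \<open>t'\<close> of this parity leaves two colours for \<open>z\<close>, which then suffice for the side of \<open>t\<close>,
    even if that side shares vertices with the side of \<open>t'\<close>.\<close>
  let ?q = "\<not> ((positive z p \<longleftrightarrow> positive z t') \<longleftrightarrow> even_col (\<phi> p))"
  obtain e1 where e1: "\<forall>c. even_col c = ?q \<longrightarrow> c \<noteq> e1 \<longrightarrow>
      (\<exists>a. a \<noteq> blocked w' u' \<phi> \<and> adj (positive u' x') a (\<phi> x') \<and> adj (positive u' t') a c)"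
    using ext_vertex by blast
  obtain e2 where e2: "\<forall>c. even_col c = ?q \<longrightarrow> c \<noteq> e2 \<longrightarrow>
      (\<exists>a. a \<noteq> blocked wv' v' \<phi> \<and> adj (positive v' y') a (\<phi> y') \<and> adj (positive v' t') a c)"
    using ext_vertex by blast
  \<comment> \<open>Of five colours, one is lost to each of \<open>u'\<close> and \<open>v'\<close>,
    and one is the copy of the colour of \<open>p\<close> for which \<open>common2\<close>
    fails.\<close>
  obtain ct where ct: "even_col ct = ?q" "ct \<noteq> e1" "ct \<noteq> e2" "ct \<noteq> flip (positive z p \<noteq> positive z t') (\<phi> p)"
    using even_col_avoid3 by blast
  obtain cu where cu: "cu \<noteq> blocked w' u' \<phi>" "adj (positive u' x') cu (\<phi> x')" "adj (positive u' t') cu ct" using e1 ct by blast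
  obtain cv where cv: "cv \<noteq> blocked wv' v' \<phi>" "adj (positive v' y') cv (\<phi> y')" "adj (positive v' t') cv ct" using e2 ct by blast
  have "even_col ct \<noteq> ((positive z p \<longleftrightarrow> positive z t') \<longleftrightarrow> even_col (\<phi> p))" using ct(1) by simp
  from common2[OF this ct(4)] obtain z1 z2 where zz: "z1 \<noteq> z2" "adj (positive z p) z1 (\<phi> p)" "adj (positive z p) z2 (\<phi> p)"
     "adj (positive z t') z1 ct" "adj (positive z t') z2 ct" by blast
  have o: "other_nbr w' u' \<noteq> t'" "other_nbr wv' v' \<noteq> t'" "other_nbr wv' v' \<noteq> u'"
    using semi_nbrs_other_plain[OF T'(5) tl'] semi_nbrs_other_plain[OF T'(6) tl']
      semi_nbrs_other_semi[OF T'(6,5)] light_distinct[OF tp(2) T'(5,6,2)] by auto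
  have notin: "x' \<noteq> z" "y' \<noteq> z" "x \<noteq> z" "y \<noteq> z" using zn' ud(6) vd(6) ud'(6) vd'(6) by auto
  have sn: "x \<notin> {u, v, u', v'}" "y \<notin> {u, v, u', v'}" "x' \<notin> {u, v, u', v'}" "y' \<notin> {u, v, u', v'}"
    using semi_nonadj(1)[OF T(5)] semi_nonadj(1)[OF T(6)] semi_nonadj(1)[OF T'(5)] semi_nonadj(1)[OF T'(6)]
      ud(15) vd(15) ud'(15) vd'(15) by blast+
  have xt: "x' \<noteq> t" if "u' \<notin> {u, v}" using ud'(6) T(1) that pl by auto
  have yt: "y' \<noteq> t" if "v' \<notin> {u, v}" using vd'(6) T(1) that pl by auto
  have g1: "good (insert t' ?W) (\<phi>(t' := ct))"
    using T' by (intro good_insert_plain[OF \<phi> _ tl']) auto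
  \<comment> \<open>A semi vertex common to \<open>t\<close> and \<open>t'\<close> is left to
    \<open>bad_extend\<close>, with \<open>t'\<close> as its outer neighbour, already
    coloured.\<close>
  define W2 \<phi>2 where "W2 = (if u' \<in> {u, v} then insert t' ?W else insert u' (insert t' ?W))"
    and "\<phi>2 = (if u' \<in> {u, v} then \<phi>(t' := ct) else \<phi>(t' := ct, u' := cu))"
  have g2: "good W2 \<phi>2"
  proof (cases "u' \<in> {u, v}")
    case True then show ?thesis using g1 unfolding W2_def \<phi>2_def by simp
  next
    case False
    have "good (insert u' (insert t' ?W)) (\<phi>(t' := ct, u' := cu))"
      using cu o ud' vd' pl light_notin_core[OF T'(5)] by (intro good_insert_semi[OF g1 T'(5)]) auto
    then show ?thesis using False unfolding W2_def \<phi>2_def by simp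
  qed
  have p2: "\<phi>2 t' = ct" "\<And>a. a \<in> ?W \<Longrightarrow> \<phi>2 a = \<phi> a" "\<And>a. a \<noteq> t' \<Longrightarrow> a \<noteq> u' \<Longrightarrow> \<phi>2 a = \<phi> a"
    unfolding \<phi>2_def using pl by auto
  have W2: "W2 \<subseteq> insert u' (insert t' ?W)" "insert t' ?W \<subseteq> W2" "u' \<notin> {u, v} \<Longrightarrow> u' \<in> W2"
     "u' \<in> {u, v} \<Longrightarrow> u' \<notin> W2" unfolding W2_def using pl by auto
  define W3 \<phi>3 where "W3 = (if v' \<in> {u, v} then W2 else insert v' W2)"
    and "\<phi>3 = (if v' \<in> {u, v} then \<phi>2 else \<phi>2(v' := cv))"
  have g3: "good W3 \<phi>3"
  proof (cases "v' \<in> {u, v}")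
    case True then show ?thesis using g2 unfolding W3_def \<phi>3_def by simp
  next
    case False
    have "wv' \<notin> W2" using light_notin_core[OF T'(6)] ud' W2(1) by blast
    moreover have "v' \<notin> W2" using W2(1) T'(2) pl by auto
    moreover have "blocked wv' v' \<phi>2 = blocked wv' v' \<phi>" unfolding blocked_def using p2(3) o by simp
    moreover have "y' \<noteq> t'" "y' \<noteq> u'" using vd' sn by auto
    then have "\<phi>2 y' = \<phi> y'" using p2(3) by simp
    ultimately have "good (insert v' W2) (\<phi>2(v' := cv))"
      using cv p2(1) by (intro good_insert_semi[OF g2 T'(6)]) auto
    then show ?thesis using False unfolding W3_def \<phi>3_def by simp
  qed
  have p3: "\<phi>3 t' = ct" "\<phi>3 p = \<phi> p" unfolding \<phi>3_def using p2 pl pW by auto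
  have W3: "W3 \<subseteq> core - {z, t, u, v}" "core - {z, t, u, v} \<subseteq> W3"
    unfolding W3_def W2_def using ud' vd' pl tz tt by auto
  then have W3eq: "W3 = core - {z, t, u, v}" by blast
  have gz: "good (insert z W3) (\<phi>3(z := cz))" if "cz = z1 \<or> cz = z2" for cz
  proof (rule good_insert_plain[OF g3 _ zl])
    show "z \<notin> W3" using W3eq by simp
    fix b assume "b \<in> nbrs z" "b \<in> W3"
    then have "b = t' \<or> b = p" using p(1) W3eq by auto
    then show "adj (positive z b) cz (\<phi>3 b)" using zz that p3 by auto
  qed
  obtain \<phi>' where "good (insert u (insert v (insert t (insert z W3)))) \<phi>'"
    by (rule bad_extend[OF g3 tp(1) T(5,6,2,1,3,4) z _ _ _ _ _ _ gz[of z1] gz[of z2] zz(1)])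
      (use W3eq ud vd sn notin in auto)
  moreover have "insert u (insert v (insert t (insert z W3))) = core" using ud vd zH W3eq by auto
  ultimately show False using not_good_core by simp
qed

section \<open>Discharging\<close>

definition transfer :: "'a \<Rightarrow> 'a \<Rightarrow> int" where
  "transfer v y = (if deg y = 2 then 3
     else if semi y then (if deg v = 2 then 0 else 1)
     else if bad y then (if semi v then 0 else 1) else 0)"

lemma transfer_nonneg: "0 \<le> transfer v y"
  by (simp add: transfer_def)

lemma transfer_le: "transfer v y \<le> 3" "deg y \<noteq> 2 \<Longrightarrow> transfer v y \<le> 1"
  by (simp_all add: transfer_def)

definition charge :: "'a \<Rightarrow> int" where
  "charge v = 7 * int (deg v) - 20 - (\<Sum>y\<in>nbrs v. transfer v y) + (\<Sum>y\<in>nbrs v. transfer y v)"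

text \<open>Transfers cancel, being subtracted at the sender and added at the receiver; the degrees
  sum to \<open>2 * card E\<close>.\<close>

lemma sum_charge: "(\<Sum>v\<in>V. charge v) = 14 * int (card E) - 20 * int (card V)"
proof -
  have eq: "{y \<in> V. y \<in> nbrs v} = nbrs v" "{y \<in> V. v \<in> nbrs y} = nbrs v" for v
    using nbrs_subset nbrs_symD by blast+
  have "(\<Sum>v\<in>V. \<Sum>y\<in>nbrs v. transfer v y) = (\<Sum>y\<in>V. \<Sum>v\<in>nbrs y. transfer v y)"
    using sum.swap_restrict[OF finite_V finite_V, of "transfer" "\<lambda>v y. y \<in> nbrs v"] unfolding eq .
  moreover have "(\<Sum>v\<in>V. int (deg v)) = 2 * int (card E)" using handshake
    by (metis of_nat_sum of_nat_mult of_nat_numeral)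
  ultimately show ?thesis
    unfolding charge_def by (simp add: sum.distrib sum_subtractf flip: sum_distrib_left)
qed

section \<open>Final charges by type of vertex\<close>

lemma charge_2: assumes "deg v = 2" shows "charge v \<ge> 0"
proof -
  have "transfer v y = 0" if y: "y \<in> nbrs v" for y
  proof -
    have "\<not> bad y" using nbrs_symD[OF y] assms unfolding bad_def plain_def by auto
    then show ?thesis using no_adjacent_light[OF assms y] assms by (simp add: transfer_def)
  qed
  moreover have "transfer y v = 3" for y using assms by (simp add: transfer_def)
  ultimately show ?thesis using assms unfolding charge_def deg_def by simp
qed

text \<open>The other two neighbours are not semi; a semi vertex sends them nothing, even if they
  are bad, and gets 1 from each: 21 - 20 - 3 + 2 = 0.\<close>

lemma charge_semi: assumes "semi v" shows "charge v \<ge> 0"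
proof -
  obtain w where w: "deg v = 3" "w \<in> nbrs v" "deg w = 2" using assms unfolding semi_def by blast
  obtain a b where "nbrs v = {w, a, b}" "a \<noteq> w" using deg3_nbrs'[OF w(1,2)] by metis
  then have a: "a \<in> nbrs v" "deg a \<noteq> 2" using deg3_one_light[OF w, of a] by auto
  obtain w' x where t: "semi_nbrs v w' x a" using semi_obtain_nbrs[OF assms a] by metis
  note td = semi_nbrsD[OF t] and T = t[unfolded semi_nbrs_def]
  have "\<not> semi x" "\<not> semi a" using semi_nonadj[OF t] by auto
  then have "transfer v x = 0" "transfer v a = 0" using T assms by (simp_all add: transfer_def)
  moreover have "transfer x v = 1" "transfer a v = 1" "transfer v w' = 3" "transfer w' v = 0" using T w(1) assms by (simp_all add: transfer_def)
  ultimately show ?thesis using T w(1) unfolding charge_def by simp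
qed

text \<open>The third neighbour \<open>z\<close> is neither semi (\<open>no_three_semi\<close>) nor
  bad (\<open>no_semi_bad\<close>), so it gets nothing and sends 1: 21 - 20 - 2 + 1 = 0.\<close>

lemma charge_bad: assumes "bad v" shows "charge v \<ge> 0"
proof -
  have vp: "plain v" "\<not> semi v" "deg v = 3" "deg v \<noteq> 2" using assms unfolding bad_def plain_def semi_def by auto
  obtain a b where ab: "a \<in> nbrs v" "b \<in> nbrs v" "a \<noteq> b" "semi a" "semi b"
    using assms unfolding bad_def by blast
  obtain z where z: "nbrs v = {a, b, z}" "z \<noteq> a" "z \<noteq> b" using deg3_nbrs[OF vp(3) ab(1,2,3)] by metis
  have zn: "z \<in> nbrs v" using z by simp
  have zs: "\<not> semi z"
  proof
    assume s: "semi z"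
    obtain w1 x1 where 1: "semi_nbrs a w1 x1 v" using semi_obtain_nbrs[OF ab(4) nbrs_symD[OF ab(1)] vp(4)] by metis
    obtain w2 x2 where 2: "semi_nbrs b w2 x2 v" using semi_obtain_nbrs[OF ab(5) nbrs_symD[OF ab(2)] vp(4)] by metis
    obtain w3 x3 where 3: "semi_nbrs z w3 x3 v" using semi_obtain_nbrs[OF s nbrs_symD[OF zn] vp(4)] by metis
    show False by (rule no_three_semi[OF vp(1) 1 2 3]) (use ab z in auto)
  qed
  have zb: "\<not> bad z" using no_semi_bad[OF vp(1) _ zn ab(4,1)] by blast
  have "deg z \<noteq> 2" "deg a \<noteq> 2" "deg b \<noteq> 2" using vp(1) z(1) unfolding plain_def by auto
  then have "transfer v a = 1" "transfer v b = 1" "transfer v z = 0" "transfer z v = 1"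
    using zs zb ab vp assms by (simp_all add: transfer_def)
  then show ?thesis using z ab(3) vp(3) transfer_nonneg[of a v] transfer_nonneg[of b v] unfolding charge_def by simp
qed

text \<open>At most one neighbour is semi or bad, and the initial charge 21 - 20 pays for
  it.\<close>

lemma charge_plain: assumes "plain v" "\<not> bad v" shows "charge v \<ge> 0"
proof -
  have d: "deg v = 3" and l: "\<forall>y\<in>nbrs v. deg y \<noteq> 2" using assms(1) unfolding plain_def by auto
  let ?A = "{y \<in> nbrs v. semi y \<or> bad y}"
  have "a = b" if "a \<in> ?A" "b \<in> ?A" for a b
  proof (rule ccontr)
    assume ne: "a \<noteq> b"
    have ns: "\<not> (semi a \<and> semi b)" using assms that ne unfolding bad_def by blast
    then show False
      using no_semi_bad[OF assms(1), of a b] no_semi_bad[OF assms(1), of b a]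
        no_two_bad[OF assms(1), of a b] that ne by blast
  qed
  then have c: "card ?A \<le> 1" using card_le_Suc0_iff_eq[of ?A] by auto
  have "(\<Sum>y\<in>nbrs v. transfer v y) \<le> (\<Sum>y\<in>nbrs v. if semi y \<or> bad y then 1 else 0)"
    using l by (intro sum_mono) (auto simp: transfer_def)
  also have "\<dots> = int (card ?A)" by (simp flip: sum.inter_filter)
  finally have "(\<Sum>y\<in>nbrs v. transfer v y) \<le> 1" using c by linarith
  moreover have "(\<Sum>y\<in>nbrs v. transfer y v) \<ge> 0" by (intro sum_nonneg transfer_nonneg)
  ultimately show ?thesis using d unfolding charge_def by simp
qed

text \<open>With at most two 2-neighbours the worst case is 28 - 20 - 2 * 3 - 2 * 1 = 0.\<close>

lemma charge_4: assumes "deg v = 4" shows "charge v \<ge> 0"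
proof -
  let ?L = "{y \<in> nbrs v. deg y = 2}"
  have L: "card ?L \<le> 2"
  proof (rule ccontr)
    assume "\<not> card ?L \<le> 2"
    then have "3 \<le> card ?L" by simp
    then obtain B where B: "B \<subseteq> ?L" "card B = 3" using obtain_subset_with_card_n by metis
    then obtain a b c where abc: "B = {a, b, c}" by (auto simp: card_3_iff)
    have "card (nbrs v - B) = 1" using assms B unfolding deg_def
      by (subst card_Diff_subset) (auto intro: finite_subset)
    then obtain y where "nbrs v - B = {y}" by (rule card_1_singletonE)
    then have "nbrs v \<subseteq> {a, b, c, y}" using abc by blast
    moreover have "v \<in> core" using assms B abc nbrs_V(2) unfolding core_def by auto
    ultimately show False using one_nonlight_nbr_reducible[of v a b c y] B abc by auto
  qed
  have "(\<Sum>y\<in>nbrs v. transfer v y) \<le> (\<Sum>y\<in>nbrs v. 1 + 2 * (if deg y = 2 then 1 else 0))"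
    using transfer_le by (intro sum_mono) auto
  also have "\<dots> = int (card (nbrs v)) + 2 * int (card ?L)"
    by (simp add: sum.distrib flip: sum.inter_filter sum_distrib_left)
  finally have "(\<Sum>y\<in>nbrs v. transfer v y) \<le> 8" using L assms unfolding deg_def by linarith
  moreover have "(\<Sum>y\<in>nbrs v. transfer y v) \<ge> 0" by (intro sum_nonneg transfer_nonneg)
  ultimately show ?thesis using assms unfolding charge_def by simp
qed

lemma charge_ge_5: assumes "deg v \<ge> 5" shows "charge v \<ge> 0"
proof -
  have "(\<Sum>y\<in>nbrs v. transfer v y) \<le> (\<Sum>y\<in>nbrs v. 3)" by (intro sum_mono transfer_le)
  then have "(\<Sum>y\<in>nbrs v. transfer v y) \<le> 3 * int (deg v)" by (simp add: deg_def)
  moreover have "(\<Sum>y\<in>nbrs v. transfer y v) \<ge> 0" by (intro sum_nonneg transfer_nonneg)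
  ultimately show ?thesis using assms unfolding charge_def by linarith
qed

lemma charge_nonneg: assumes "v \<in> V" shows "charge v \<ge> 0"
proof -
  consider "deg v = 2" | "deg v = 3" | "deg v = 4" | "deg v \<ge> 5" using deg_ge_2[OF assms] by linarith
  then show ?thesis
  proof cases
    case 2
    then consider "semi v" | "bad v" | "plain v" "\<not> bad v" unfolding semi_def plain_def by blast
    then show ?thesis using charge_semi charge_bad charge_plain by cases
  qed (use charge_2 charge_4 charge_ge_5 in blast)+
qed

theorem no_critical: False
proof -
  have "0 \<le> (\<Sum>v\<in>V. charge v)" by (intro sum_nonneg charge_nonneg)
  then show False using sum_charge sparse[OF V_ne] by linarith
qed

end

section \<open>From colourings to homomorphisms\<close>

lemma switch_set:
  assumes "finite X" "X \<subseteq> V"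
  shows "switch_equiv V E s (\<lambda>e. s e * (- 1) ^ card (X \<inter> e))"
  using assms
proof (induction X rule: finite_induct)
  case empty
  then show ?case using switch_equiv.refl[of V E s] by simp
next
  case (insert x X)
  have "switch_vertex x (\<lambda>e. s e * (- 1) ^ card (X \<inter> e)) = (\<lambda>e. s e * (- 1) ^ card (insert x X \<inter> e))"
    using insert.hyps by (auto simp: switch_vertex_def Int_insert_left fun_eq_iff)
  then show ?case using switch_equiv.step[OF insert.IH, of x] insert.prems by simp
qed

text \<open>The squares modulo 5 are 0, 1 and 4; they are closed under negation, so the order of the
  two ends chosen in \<open>SP5_s\<close> does not matter.\<close>

lemma SP5_s_eq: "SP5_s {i, j} = (if (i - j) mod 5 \<in> {0, 1, 4} then 1 else - 1)"
proof -
  have sq: "x ^ 2 mod 5 \<in> {0, 1, 4}" for x :: int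
  proof -
    have "x mod 5 \<in> {0, 1, 2, 3, 4}" by auto
    moreover have "x ^ 2 mod 5 = (x mod 5) ^ 2 mod 5" by (simp add: power_mod)
    ultimately show ?thesis by auto
  qed
  have "(\<exists>u v x. {i, j} = {u, v} \<and> [x ^ 2 = u - v] (mod 5)) \<longleftrightarrow> (i - j) mod 5 \<in> {0, 1, 4}"
  proof
    assume "\<exists>u v x. {i, j} = {u, v} \<and> [x ^ 2 = u - v] (mod 5)"
    then obtain u v x where u: "{i, j} = {u, v}" "x ^ 2 mod 5 = (u - v) mod 5" unfolding cong_def by blast
    have "(u - v) mod 5 \<in> {0, 1, 4}" using sq[of x] u(2) by simp
    then have "(v - u) mod 5 \<in> {0, 1, 4}" by simp presburger
    then show "(i - j) mod 5 \<in> {0, 1, 4}" using u(1) \<open>(u - v) mod 5 \<in> {0, 1, 4}\<close>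
      by (auto simp: doubleton_eq_iff)
  next
    assume "(i - j) mod 5 \<in> {0, 1, 4}"
    then consider "(i - j) mod 5 = 0\<^sup>2 mod 5" | "(i - j) mod 5 = 1\<^sup>2 mod 5" | "(i - j) mod 5 = 2\<^sup>2 mod 5" by auto
    then have "\<exists>x. x\<^sup>2 mod 5 = (i - j) mod 5" by cases metis+
    then show "\<exists>u v x. {i, j} = {u, v} \<and> [x ^ 2 = u - v] (mod 5)" unfolding cong_def by blast
  qed
  then show ?thesis unfolding SP5_s_def by simp
qed

definition residue5 :: "10 \<Rightarrow> int" where
  "residue5 c = (if c \<in> {0, 5} then 0 else if c \<in> {1, 6} then 1 else if c \<in> {2, 7} then 2
     else if c \<in> {3, 8} then 3 else 4)"

lemma residue5_SP5_V: "residue5 c \<in> SP5_V"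
  by (simp add: residue5_def SP5_V_def)

text \<open>The second factor is the effect of switching: it is -1 when exactly one end is used with
  a switch.\<close>

lemma adj_residue5:
  assumes "adj b c d"
  shows "{residue5 c, residue5 d} \<in> SP5_E"
    and "SP5_s {residue5 c, residue5 d} = (if b then 1 else - 1) * (if even_col c = even_col d then 1 else - 1)"
proof -
  have "\<forall>c d. pos_adj c d \<longrightarrow> residue5 c \<noteq> residue5 d \<and>
      ((residue5 c - residue5 d) mod 5 \<in> {0, 1, 4} \<longleftrightarrow> even_col c = even_col d)"
    unfolding all_10 pos_adj_def residue5_def even_col_def by simp
  moreover have "residue5 (flip b d) = residue5 d"
  proof -
    have "\<forall>d. residue5 (d + 5) = residue5 d" unfolding all_10 residue5_def by simp
    then show ?thesis by (simp add: flip_def)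
  qed
  ultimately have *: "residue5 c \<noteq> residue5 d" "(residue5 c - residue5 d) mod 5 \<in> {0, 1, 4} \<longleftrightarrow> even_col c = even_col (flip b d)"
    using assms unfolding adj_def by metis+
  show "{residue5 c, residue5 d} \<in> SP5_E" using *(1) residue5_SP5_V unfolding SP5_E_def by blast
  show "SP5_s {residue5 c, residue5 d} = (if b then 1 else - 1) * (if even_col c = even_col d then 1 else - 1)"
    unfolding SP5_s_eq *(2) even_col_flip by auto
qed

lemma (in sgraph) valid_imp_hom:
  assumes "valid V \<phi>"
  shows "signed_hom V E s SP5_V SP5_E SP5_s (\<lambda>v. residue5 (\<phi> v))"
proof -
  \<comment> \<open>The vertices with odd colours are the ones to switch.\<close>
  let ?X = "{v \<in> V. \<not> even_col (\<phi> v)}"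
  let ?t = "\<lambda>e. s e * (- 1) ^ card (?X \<inter> e)"
  have "switch_equiv V E s ?t" using finite_V by (intro switch_set) auto
  moreover have "{residue5 (\<phi> u), residue5 (\<phi> v)} \<in> SP5_E \<and> SP5_s {residue5 (\<phi> u), residue5 (\<phi> v)} = ?t {u, v}"
    if e: "{u, v} \<in> E" for u v
  proof -
    have n: "v \<in> nbrs u" using e unfolding nbrs_def by (simp add: insert_commute)
    have uv: "u \<in> V" "v \<in> V" "u \<noteq> v" using nbrs_V[OF n] by auto
    have a: "adj (positive u v) (\<phi> u) (\<phi> v)" using assms n uv unfolding valid_def by blast
    have s: "s {u, v} = (if positive u v then 1 else - 1)"
      using signed e unfolding signed_graph_def positive_def by auto
    have "?X \<inter> {u, v} = (if even_col (\<phi> u) then {} else {u}) \<union> (if even_col (\<phi> v) then {} else {v})"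
      using uv by auto
    then have "(- 1) ^ card (?X \<inter> {u, v}) = (if even_col (\<phi> u) = even_col (\<phi> v) then 1 else - 1 :: int)"
      using uv(3) by simp
    then show ?thesis using adj_residue5[OF a] s by simp
  qed
  ultimately show ?thesis unfolding signed_hom_def using residue5_SP5_V by blast
qed

section \<open>Induced subgraphs and the induction\<close>

lemma mad_sparse:
  assumes "signed_graph V E s" "mad V E < 20 / 7" "W \<subseteq> V" "W \<noteq> {}"
  shows "7 * card {e \<in> E. e \<subseteq> W} < 10 * card W"
proof -
  have V: "finite V" using assms(1) unfolding signed_graph_def by (rule conjunct1)
  have "E \<subseteq> Pow V"
  proof
    fix e assume "e \<in> E"
    then obtain u v where "u \<in> V" "v \<in> V" "e = {u, v}" using sgraph.edge_cases[OF sgraph.intro[OF assms(1)]] by metis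
    then show "e \<in> Pow V" by simp
  qed
  then have E: "finite E" using V by (simp add: finite_subset)
  let ?f = "\<lambda>(W, F). 2 * real (card F) / real (card W)"
  let ?M = "{2 * real (card F) / real (card W) | W F. W \<subseteq> V \<and> W \<noteq> {} \<and> F \<subseteq> E \<and> (\<forall>e\<in>F. e \<subseteq> W)}"
  have "?M \<subseteq> ?f ` (Pow V \<times> Pow E)" by force
  then have "finite ?M" by (rule finite_subset) (simp add: V E)
  moreover have "2 * real (card {e \<in> E. e \<subseteq> W}) / real (card W) \<in> ?M" using assms(3,4) by blast
  ultimately have "2 * real (card {e \<in> E. e \<subseteq> W}) / real (card W) \<le> mad V E"
    unfolding mad_def by (rule Max_ge)
  then have "2 * real (card {e \<in> E. e \<subseteq> W}) / real (card W) < 20 / 7" using assms(2) by simp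
  moreover have "card W > 0" using assms(3,4) V finite_subset card_gt_0_iff by metis
  ultimately have "7 * real (card {e \<in> E. e \<subseteq> W}) < 10 * real (card W)"
    by (simp add: field_simps)
  then show ?thesis by linarith
qed

lemma induced_signed_graph:
  assumes "signed_graph V E s" "W \<subseteq> V"
  shows "signed_graph W {e \<in> E. e \<subseteq> W} s"
proof -
  have "\<exists>u v. u \<in> W \<and> v \<in> W \<and> u \<noteq> v \<and> e = {u, v}" if e: "e \<in> {e \<in> E. e \<subseteq> W}" for e
  proof -
    have "e \<in> E" using e by simp
    then obtain u v where "u \<noteq> v" "e = {u, v}" using sgraph.edge_cases[OF sgraph.intro[OF assms(1)]] by metis
    then show ?thesis using e by blast
  qed
  moreover have "finite W" using assms finite_subset unfolding signed_graph_def by blast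
  moreover have "\<forall>e\<in>E. s e = 1 \<or> s e = -1" using assms(1) unfolding signed_graph_def by (elim conjE)
  ultimately show ?thesis unfolding signed_graph_def by blast
qed

text \<open>Induced subgraphs inherit the density bound by \<open>mad_sparse\<close>, so a smallest
  uncolourable \<open>W\<close> would induce a critical graph, against
  \<open>no_critical\<close>.\<close>

lemma sparse_colourable:
  assumes G: "signed_graph V E s" and "mad V E < 20 / 7" and "W \<subseteq> V"
  shows "\<exists>\<phi>. sgraph.valid {e \<in> E. e \<subseteq> W} s W \<phi>"
proof -
  have "finite W" using G assms(3) finite_subset unfolding signed_graph_def by blast
  then show ?thesis using assms(3)
  proof (induction W rule: finite_psubset_induct)
    case (psubset W)
    interpret sgraph W "{e \<in> E. e \<subseteq> W}" s
      using induced_signed_graph[OF G psubset.prems] by (rule sgraph.intro)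
    show ?case
    proof (rule ccontr)
      assume nc: "\<not> (\<exists>\<phi>. valid W \<phi>)"
      have "\<exists>\<phi>. valid U \<phi>" if U: "U \<subset> W" for U
      proof -
        have UV: "U \<subseteq> V" using U psubset.prems by blast
        interpret U: sgraph U "{e \<in> E. e \<subseteq> U}" s
          using induced_signed_graph[OF G UV] by (rule sgraph.intro)
        obtain \<phi> where "U.valid U \<phi>" using psubset.IH[OF U UV] by blast
        then have "valid U \<phi>"
          using U unfolding valid_def U.valid_def nbrs_def U.nbrs_def positive_def U.positive_def by blast
        then show ?thesis by blast
      qed
      then interpret critical W "{e \<in> E. e \<subseteq> W}" s
        using nc mad_sparse[OF assms(1,2) psubset.prems] by unfold_locales blast+
      show False by (rule no_critical)
    qed
  qed
qed

theorem theorem2: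
  fixes V :: "'a set" and E :: "'a set set" and s :: "'a set \<Rightarrow> int"
  assumes "signed_graph V E s"
    and "mad V E < 20 / 7"
  shows "\<exists>\<phi>. signed_hom V E s SP5_V SP5_E SP5_s \<phi>"
proof -
  interpret sgraph V E s using assms(1) by (rule sgraph.intro)
  have "e \<subseteq> V" if "e \<in> E" for e using edge_cases[OF that] by blast
  then have "{e \<in> E. e \<subseteq> V} = E" by blast
  then obtain \<phi> where "valid V \<phi>" using sparse_colourable[OF assms subset_refl] by auto
  then show ?thesis using valid_imp_hom by blast
qed

end
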